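(* For $n\in\mathbb{N}$ let $$\psi_{n,1}(x)=\sum_{k=0}^{\infty}\left(p_{n,k}^{[1]}(x)\right)^2,$$ regarded as a rational function of the complex variable $x$. Then all complex zeros of $\psi_{n,1}$ follow the equilibrium measure on the disk $D_{\frac12}\left(-\frac12\right)$ as $n\to\infty$; that is, the normalized zero counting measures of $\psi_{n,1}$ converge, as $n\to\infty$, in the weak-star sense to the uniform distribution (normalized arc length measure) on the circle $\left|x+\frac12\right|=\frac12$. In particular, for large values of $n$ all the zeros approach the boundary of $D_{\frac12}\left(-\frac12\right)$ (i.e. for every $\varepsilon>0$ there is $n_0$ such that for all $n\geq n_0$ every zero of $\psi_{n,1}$ has distance less than $\varepsilon$ from the circle $\left|x+\frac12\right|=\frac12$), and they are uniformly distributed in the limit.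
   Context: For $n\in\mathbb{N}$ and $k\in\mathbb{N}\cup\{0\}$, $$p_{n,k}^{[1]}(x)=\binom{-n}{k}(-x)^k(1+x)^{-n-k},\quad x\geq 0,$$ where $\binom{-n}{k}=\frac{(-n)(-n-1)\cdots(-n-k+1)}{k!}$ and $0^0=1$. For $x\ge 0$ the sum $\psi_{n,1}(x)$ coincides with a rational function of $x$; $\psi_{n,1}$ denotes this rational function on $\mathbb{C}$, and its zeros are its zeros in $\mathbb{C}$ counted with multiplicity (for $n=1$ there are none; the limit concerns $n\ge 2$). $D_{\frac12}\left(-\frac12\right)$ is the disk in $\mathbb{C}$ with center $-\frac12$ and radius $\frac12$. The normalized zero counting measure is $\frac1N\sum_{\zeta}\delta_\zeta$, the sum running over the zeros $\zeta$ counted with multiplicity and $N$ being their total number. Weak-star convergence $\mu_n\to\mu$ means $\int h\,d\mu_n\to\int h\,d\mu$ for every continuous compactly supported $h:\mathbb{C}\to\mathbb{R}$. The equilibrium measure (in the sense of logarithmic potential theory) of a closed disk is the normalized arc length measure on its boundary circle. *)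

theory Defs
  imports
    "HOL-Probability.Probability"
    "HOL-Computational_Algebra.Computational_Algebra"
    "HOL-Computational_Algebra.Field_as_Ring"
begin

definition baskakov :: "nat \<Rightarrow> nat \<Rightarrow> real \<Rightarrow> real" where
  "baskakov n k x = ((- real n) gchoose k) * (- x) ^ k * (1 + x) powi (- int (n + k))"

text \<open>
  A rational function over the complex numbers is an element of the fraction field of the
  polynomial ring. It is evaluated, and its zeros are read off with multiplicity, from its
  representation in lowest terms. At a pole, \<open>ratfun_eval\<close> returns the junk value 0.
\<close>

type_synonym ratfun = "complex poly fract"

definition ratfun_eval :: "ratfun \<Rightarrow> complex \<Rightarrow> complex" where
  "ratfun_eval r z = poly (fst (quot_of_fract r)) z / poly (snd (quot_of_fract r)) z"

definition ratfun_zeros :: "ratfun \<Rightarrow> complex multiset" where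
  "ratfun_zeros r = proots (fst (quot_of_fract r))"

text \<open>
  The rational function that agrees with the series on the nonnegative reals. Since the term for
  \<open>k = 0\<close> is positive, such a function has no poles there. Existence and uniqueness for \<open>n \<ge> 1\<close>
  are shown in \<open>ex1_psi\<close> below.
\<close>

definition psi :: "nat \<Rightarrow> ratfun" where
  "psi n = (THE r. \<forall>x\<ge>0. (\<lambda>k. complex_of_real ((baskakov n k x)\<^sup>2)) sums
                            ratfun_eval r (complex_of_real x))"

text \<open>
  The uniform distribution on a multiset gives each point a mass proportional to its multiplicity,
  see \<open>zero_counting_measure_eq\<close> below. It is a junk value if there are no zeros.
\<close>

definition zero_counting_measure :: "ratfun \<Rightarrow> complex measure" where
  "zero_counting_measure r = distr (measure_pmf (pmf_of_multiset (ratfun_zeros r))) borel (\<lambda>z. z)"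

text \<open>
  Normalized arc length measure on a circle, which is the equilibrium measure of the closed disk
  that it bounds.
\<close>

definition circle_measure :: "complex \<Rightarrow> real \<Rightarrow> complex measure" where
  "circle_measure c r =
     distr (uniform_measure lborel {0..2 * pi}) borel (\<lambda>t. c + complex_of_real r * cis t)"

definition weak_star_converges :: "(nat \<Rightarrow> complex measure) \<Rightarrow> complex measure \<Rightarrow> bool" where
  "weak_star_converges \<mu> \<nu> \<longleftrightarrow>
     (\<forall>h :: complex \<Rightarrow> real. continuous_on UNIV h \<and> compact (closure {z. h z \<noteq> 0}) \<longrightarrow>
        (\<lambda>n. \<integral>z. h z \<partial>\<mu> n) \<longlonglongrightarrow> (\<integral>z. h z \<partial>\<nu>))"


subsection \<open>Well-definedness\<close>

lemma sum_mset_eq_sum_count: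
  fixes f :: "'a \<Rightarrow> real"
  shows "(\<Sum>x\<in>#M. f x) = (\<Sum>x\<in>set_mset M. real (count M x) * f x)"
proof -
  have "(\<Sum>x\<in>#M. f x) = (\<Sum>x\<in>S. real (count M x) * f x)" if "finite S" "set_mset M \<subseteq> S" for S
    using that(2)
  proof (induction M)
    case (add y M)
    have "(\<Sum>x\<in>S. real (count (add_mset y M) x) * f x) =
            (\<Sum>x\<in>S. real (count M x) * f x + (if x = y then f x else 0))"
      by (intro sum.cong) (auto simp: algebra_simps)
    also have "\<dots> = (\<Sum>x\<in>S. real (count M x) * f x) + f y"
      using add.prems that(1) by (simp add: sum.distrib)
    finally show ?case using add by simp
  qed simp
  then show ?thesis by simp
qed

lemma zero_counting_measure_eq:
  assumes "ratfun_zeros r \<noteq> {#}" and "A \<in> sets borel"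
  shows "measure (zero_counting_measure r) A =
           (\<Sum>\<zeta>\<in>#ratfun_zeros r. indicator A \<zeta>) / real (size (ratfun_zeros r))"
proof -
  define Z where "Z = ratfun_zeros r"
  have Z: "Z \<noteq> {#}" using assms by (simp add: Z_def)
  have "measure (zero_counting_measure r) A = measure (measure_pmf (pmf_of_multiset Z)) A"
    unfolding zero_counting_measure_def Z_def[symmetric]
    using assms(2) by (subst measure_distr) auto
  also have "\<dots> = measure (measure_pmf (pmf_of_multiset Z)) (A \<inter> set_mset Z)"
    using Z by (metis measure_Int_set_pmf set_pmf_of_multiset)
  also have "\<dots> = (\<Sum>\<zeta>\<in>A \<inter> set_mset Z. pmf (pmf_of_multiset Z) \<zeta>)"
    by (rule measure_measure_pmf_finite) auto
  also have "\<dots> = (\<Sum>\<zeta>\<in>set_mset Z. real (count Z \<zeta>) * indicator A \<zeta> / real (size Z))"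
    using Z by (intro sum.mono_neutral_cong_left) (auto simp: indicator_def)
  also have "\<dots> = (\<Sum>\<zeta>\<in>#Z. indicator A \<zeta>) / real (size Z)"
    by (simp only: sum_mset_eq_sum_count sum_divide_distrib)
  finally show ?thesis by (simp add: Z_def)
qed

lemma ratfun_eval_Fract:
  assumes "poly b z \<noteq> 0"
  shows "ratfun_eval (Fract a b) z = poly a z / poly b z"
proof -
  have b: "b \<noteq> 0" using assms by auto
  have q: "quot_of_fract (Fract a b) = normalize_quot (a, b)"
    using quot_of_fract_quot_to_fract[of "(a, b)"] b by (simp add: quot_to_fract_def)
  obtain d where "a = fst (normalize_quot (a,b)) * d" "b = snd (normalize_quot (a,b)) * d"
    using normalize_quotE[OF b, of a] by metis
  then have "poly a z = poly (fst (normalize_quot (a,b))) z * poly d z"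
            "poly b z = poly (snd (normalize_quot (a,b))) z * poly d z"
    by (metis poly_mult)+
  then show ?thesis using assms by (simp add: ratfun_eval_def q)
qed

lemma ratfun_eqI:
  assumes "\<And>x. x \<ge> 0 \<Longrightarrow> ratfun_eval r (complex_of_real x) = ratfun_eval s (complex_of_real x)"
  shows "r = s"
proof -
  define a b c d where abcd: "a = fst (quot_of_fract r)" "b = snd (quot_of_fract r)"
    "c = fst (quot_of_fract s)" "d = snd (quot_of_fract s)"
  have b: "b \<noteq> 0" and d: "d \<noteq> 0" by (auto simp: abcd)
  have "(a * d - c * b) * (b * d) = 0"
  proof (rule ccontr)
    assume "(a * d - c * b) * (b * d) \<noteq> 0"
    then have "finite {z. poly ((a * d - c * b) * (b * d)) z = 0}"
      by (rule poly_roots_finite)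
    moreover have "poly ((a * d - c * b) * (b * d)) (complex_of_real x) = 0" if "x \<ge> 0" for x
    proof (cases "poly b (complex_of_real x) = 0 \<or> poly d (complex_of_real x) = 0")
      case False
      with assms[OF that] show ?thesis by (simp add: ratfun_eval_def abcd[symmetric] frac_eq_eq)
    qed auto
    then have "complex_of_real ` {0..} \<subseteq> {z. poly ((a * d - c * b) * (b * d)) z = 0}" by auto
    ultimately have "finite (complex_of_real ` {0..})" by (rule finite_subset[rotated])
    then have "finite ({0..} :: real set)" by (rule finite_imageD) (auto simp: inj_on_def)
    then show False using infinite_Ici by blast
  qed
  then have "a * d = c * b" using b d by auto
  then have "Fract a b = Fract c d" using b d by (simp add: eq_fract)
  then show ?thesis by (simp add: abcd)
qed

lemma sums_rational_step:
  fixes a :: "nat \<Rightarrow> complex"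
  assumes sm: "\<And>t. norm t < 1 \<Longrightarrow> (\<lambda>k. a k * t ^ k) sums (poly P t / (1 - t) ^ q)"
  obtains Q where "\<And>t. norm t < 1 \<Longrightarrow>
    (\<lambda>k. (c + of_nat k) * a k * t ^ k) sums (poly Q t / (1 - t) ^ Suc q)"
proof -
  define Q where "Q = smult c (P * [:1, -1:]) + [:0, 1:] * (pderiv P * [:1, -1:] + smult (of_nat q) P)"
  have "(\<lambda>k. (c + of_nat k) * a k * t ^ k) sums (poly Q t / (1 - t) ^ Suc q)"
    if t: "norm t < 1" for t
  proof -
    have t1: "1 - t \<noteq> 0" using t by auto
    define D where "D = (poly (pderiv P) t * (1 - t) + of_nat q * poly P t) / (1 - t) ^ Suc q"
    have ev: "eventually (\<lambda>u. u \<in> ball 0 1) (nhds t)"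
      using t by (intro eventually_nhds_in_open) auto
    have "((\<lambda>u. poly P u / (1 - u) ^ q) has_field_derivative
        (poly (pderiv P) t * (1 - t) ^ q + poly P t * (of_nat q * (1 - t) ^ (q - 1)))
          / ((1 - t) ^ q * (1 - t) ^ q)) (at t)"
      using t1 by (auto intro!: derivative_eq_intros)
    also have "(poly (pderiv P) t * (1 - t) ^ q + poly P t * (of_nat q * (1 - t) ^ (q - 1)))
          / ((1 - t) ^ q * (1 - t) ^ q) = D"
    proof (cases q)
      case (Suc p)
      have "(1 - t) ^ p \<noteq> 0" using t1 by simp
      with t1 show ?thesis unfolding D_def Suc
        by (simp add: frac_eq_eq) (simp add: algebra_simps)
    qed (use t1 in \<open>simp add: D_def\<close>)
    finally have "((\<lambda>u. poly P u / (1 - u) ^ q) has_field_derivative D) (at t)" .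
    moreover have "eventually (\<lambda>u. (\<Sum>k. a k * u ^ k) = poly P u / (1 - u) ^ q) (nhds t)"
      using ev by eventually_elim (use sm sums_unique in force)
    ultimately have 1: "((\<lambda>u. \<Sum>k. a k * u ^ k) has_field_derivative D) (at t)"
      by (subst DERIV_cong_ev[OF refl _ refl]) auto
    have summ: "summable (\<lambda>k. a k * u ^ k)" if "norm u < 1" for u
      using sm[OF that] by (auto simp: sums_iff)
    have 2: "((\<lambda>u. \<Sum>k. a k * u ^ k) has_field_derivative (\<Sum>k. diffs a k * t ^ k)) (at t)"
      by (rule termdiffs_strong'[where K = 1]) (use summ t in auto)
    have "summable (\<lambda>k. diffs a k * t ^ k)"
      by (rule termdiff_converges[where K = 1]) (use summ t in auto)
    then have "(\<lambda>k. diffs a k * t ^ k) sums D"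
      using DERIV_unique[OF 1 2] by (simp add: sums_iff)
    then have "(\<lambda>k. t * (diffs a k * t ^ k)) sums (t * D)" by (rule sums_mult)
    then have "(\<lambda>k. of_nat (Suc k) * a (Suc k) * t ^ Suc k) sums (t * D)"
      by (simp add: diffs_def algebra_simps)
    then have "(\<lambda>k. of_nat k * a k * t ^ k) sums (t * D)"
      by (subst (asm) sums_Suc_iff) simp
    from sums_add[OF sums_mult[OF sm[OF t], of c] this]
    have "(\<lambda>k. (c + of_nat k) * a k * t ^ k) sums (c * (poly P t / (1 - t) ^ q) + t * D)"
      by (simp add: algebra_simps)
    also have "c * (poly P t / (1 - t) ^ q) + t * D = poly Q t / (1 - t) ^ Suc q"
      using t1 by (simp add: Q_def D_def divide_simps) (simp add: algebra_simps)
    finally show ?thesis .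
  qed
  then show ?thesis using that by blast
qed

lemma sums_rational:
  "\<exists>P q. \<forall>t::complex. norm t < 1 \<longrightarrow>
     (\<lambda>k. (of_nat ((n + k) choose k))\<^sup>2 * t ^ k) sums (poly P t / (1 - t) ^ q)"
proof (induction n)
  case 0
  have "\<forall>t::complex. norm t < 1 \<longrightarrow>
     (\<lambda>k. (of_nat ((0 + k) choose k))\<^sup>2 * t ^ k) sums (poly 1 t / (1 - t) ^ 1)"
    using geometric_sums by auto
  then show ?case by blast
next
  case (Suc n)
  define a where "a k = (of_nat ((n + k) choose k) :: complex)\<^sup>2" for k
  define m where "m = (of_nat (Suc n) :: complex)"
  have m: "m \<noteq> 0" by (simp add: m_def del: of_nat_Suc)
  obtain P q where P: "\<And>t. norm t < 1 \<Longrightarrow> (\<lambda>k. a k * t ^ k) sums (poly P t / (1 - t) ^ q)"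
    using Suc by (auto simp: a_def)
  from sums_rational_step[OF P, of m]
  obtain Q where Q: "\<And>t. norm t < 1 \<Longrightarrow>
      (\<lambda>k. ((m + of_nat k) * a k) * t ^ k) sums (poly Q t / (1 - t) ^ Suc q)"
    by blast
  from sums_rational_step[OF Q, of m]
  obtain R where R: "\<And>t. norm t < 1 \<Longrightarrow>
      (\<lambda>k. (m + of_nat k) * ((m + of_nat k) * a k) * t ^ k) sums (poly R t / (1 - t) ^ Suc (Suc q))"
    by blast
  have eq: "(of_nat ((Suc n + k) choose k))\<^sup>2 = (1 / m\<^sup>2) * ((m + of_nat k) * ((m + of_nat k) * a k))"
    for k
  proof -
    have "(Suc n + k) choose k = Suc (n + k) choose Suc n" "(n + k) choose k = (n + k) choose n"
      using binomial_symmetric[of k "Suc n + k"] binomial_symmetric[of k "n + k"]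
      by (simp_all del: binomial_Suc_Suc)
    then have "Suc n * ((Suc n + k) choose k) = (Suc n + k) * ((n + k) choose k)"
      using Suc_times_binomial_eq[of "n + k" n] by (simp only: add_Suc mult.commute)
    then have "m * of_nat ((Suc n + k) choose k) = (m + of_nat k) * of_nat ((n + k) choose k)"
      unfolding m_def by (metis of_nat_add of_nat_mult)
    then have "of_nat ((Suc n + k) choose k) = (m + of_nat k) * of_nat ((n + k) choose k) / m"
      using m by (simp only: nonzero_eq_divide_eq[OF m] mult.commute)
    then show ?thesis by (simp add: a_def power2_eq_square)
  qed
  have "(\<lambda>k. (of_nat ((Suc n + k) choose k))\<^sup>2 * t ^ k) sums
          (poly (smult (1 / m\<^sup>2) R) t / (1 - t) ^ Suc (Suc q))" if "norm t < 1" for t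
    using sums_mult[OF R[OF that], of "1 / m\<^sup>2"] unfolding eq by (simp add: mult.assoc)
  then show ?case by blast
qed

lemma baskakov_sq:
  assumes "x \<ge> 0"
  shows "(baskakov (Suc n) k x)\<^sup>2 =
           ((real ((n + k) choose k))\<^sup>2 * ((x / (1 + x))\<^sup>2) ^ k) / (1 + x) ^ (2 * Suc n)"
proof -
  have x: "1 + x \<noteq> 0" using assms by auto
  have "(- real (Suc n)) gchoose k = (-1) ^ k * (real (n + k) gchoose k)"
    by (subst gbinomial_minus) (simp add: algebra_simps)
  then have g: "(- real (Suc n)) gchoose k = (-1) ^ k * real ((n + k) choose k)"
    by (simp add: binomial_gbinomial)
  have "baskakov (Suc n) k x = ((-1) * (-x)) ^ k * real ((n + k) choose k) / (1 + x) ^ (Suc n + k)"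
    unfolding baskakov_def g power_int_minus power_int_of_nat power_mult_distrib
    by (simp add: divide_inverse)
  also have "\<dots> = real ((n + k) choose k) * (x / (1 + x)) ^ k / (1 + x) ^ Suc n"
    using x by (simp add: power_add power_divide field_simps)
  finally have "baskakov (Suc n) k x = \<dots>" .
  then show ?thesis
    by (simp only: power_divide power_mult_distrib power_mult[symmetric] mult.commute)
qed

theorem ex1_psi:
  assumes "n \<ge> 1"
  shows "\<exists>!r. \<forall>x\<ge>0. (\<lambda>k. complex_of_real ((baskakov n k x)\<^sup>2)) sums
                        ratfun_eval r (complex_of_real x)"
proof -
  obtain m where n: "n = Suc m" using assms by (cases n) auto
  obtain P q where P: "\<And>t::complex. norm t < 1 \<Longrightarrow>
     (\<lambda>k. (of_nat ((m + k) choose k))\<^sup>2 * t ^ k) sums (poly P t / (1 - t) ^ q)"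
    using sums_rational[of m] by blast
  define d where "d = degree P"
  define A where "A = (\<Sum>i\<le>d. smult (coeff P i) ([:0, 1:] ^ (2 * i) * [:1, 1:] ^ (2 * (d - i))))"
  define B :: "complex poly" where "B = [:1, 1:] ^ (2 * n + 2 * d) * [:1, 2:] ^ q"
  define r where "r = Fract (A * [:1, 1:] ^ (2 * q)) B"
  have "(\<lambda>k. complex_of_real ((baskakov n k x)\<^sup>2)) sums ratfun_eval r (complex_of_real x)"
    if x: "x \<ge> 0" for x
  proof -
    define z where "z = complex_of_real x"
    define t where "t = (z / (1 + z))\<^sup>2"
    have z1: "1 + z \<noteq> 0" "1 + 2 * z \<noteq> 0"
    proof -
      have "1 + z = complex_of_real (1 + x)" "1 + 2 * z = complex_of_real (1 + 2 * x)"
        by (simp_all add: z_def)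
      moreover have "1 + x \<noteq> 0" "1 + 2 * x \<noteq> 0" using x by auto
      ultimately show "1 + z \<noteq> 0" "1 + 2 * z \<noteq> 0" by (simp_all only: of_real_eq_0_iff not_False_eq_True)
    qed
    have t_real: "t = complex_of_real ((x / (1 + x))\<^sup>2)" by (simp add: t_def z_def)
    have "(x / (1 + x))\<^sup>2 < 1" using x by (intro power_less_one_iff[THEN iffD2]) auto
    then have "norm t < 1" by (simp only: t_real norm_of_real) auto
    from sums_divide[OF P[OF this], of "(1 + z) ^ (2 * n)"]
    have "(\<lambda>k. (of_nat ((m + k) choose k))\<^sup>2 * t ^ k / (1 + z) ^ (2 * n)) sums
            (poly P t / (1 - t) ^ q / (1 + z) ^ (2 * n))" .
    moreover have "(of_nat ((m + k) choose k))\<^sup>2 * t ^ k / (1 + z) ^ (2 * n) =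
        complex_of_real ((baskakov n k x)\<^sup>2)" for k
      unfolding n baskakov_sq[OF x] by (simp add: t_real z_def)
    moreover have "poly P t / (1 - t) ^ q / (1 + z) ^ (2 * n) = ratfun_eval r z"
    proof -
      have "poly A z = (\<Sum>i\<le>d. coeff P i * (z ^ (2 * i) * (1 + z) ^ (2 * (d - i))))"
        by (simp add: A_def poly_sum)
      also have "\<dots> = (\<Sum>i\<le>d. (1 + z) ^ (2 * d) * (coeff P i * t ^ i))"
      proof (rule sum.cong[OF refl])
        fix i assume "i \<in> {..d}"
        then have "(1 + z) ^ (2 * d) = (1 + z) ^ (2 * i) * (1 + z) ^ (2 * (d - i))"
          by (simp add: power_add[symmetric] distrib_left[symmetric])
        then show "coeff P i * (z ^ (2 * i) * (1 + z) ^ (2 * (d - i))) =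
            (1 + z) ^ (2 * d) * (coeff P i * t ^ i)"
          using z1 by (simp add: t_def power_mult[symmetric] power_divide)
      qed
      also have "\<dots> = (1 + z) ^ (2 * d) * poly P t"
        by (simp add: poly_altdef d_def sum_distrib_left)
      finally have A: "poly A z = (1 + z) ^ (2 * d) * poly P t" .
      have "1 - t = (1 + 2 * z) / (1 + z)\<^sup>2"
      proof -
        have "1 - t = ((1 + z)\<^sup>2 - z\<^sup>2) / (1 + z)\<^sup>2"
          using z1 by (simp add: t_def power_divide diff_divide_distrib)
        also have "(1 + z)\<^sup>2 - z\<^sup>2 = 1 + 2 * z"
          by (simp add: power2_eq_square algebra_simps)
        finally show ?thesis .
      qed
      then have T: "(1 - t) ^ q = (1 + 2 * z) ^ q / (1 + z) ^ (2 * q)"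
        by (simp add: power_divide power_mult)
      have B: "poly B z = (1 + z) ^ (2 * n + 2 * d) * (1 + 2 * z) ^ q"
        by (simp add: B_def mult.commute)
      have "ratfun_eval r z = poly (A * [:1, 1:] ^ (2 * q)) z / poly B z"
        unfolding r_def by (rule ratfun_eval_Fract) (use z1 B in auto)
      also have "\<dots> = poly P t / (1 - t) ^ q / (1 + z) ^ (2 * n)"
        unfolding B T using z1 by (simp add: A power_add)
      finally show ?thesis ..
    qed
    ultimately show ?thesis by (simp add: z_def)
  qed
  then show ?thesis
    by (intro ex1I[of _ r]) (blast intro: ratfun_eqI sums_unique2)+
qed

end

theory Submission
  imports Defs
begin

text \<open>
  Put \<open>n = m + 1\<close> and \<open>u = 1 + 2 * x\<close>. The series and the Legendre polynomials satisfy the same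
  three-term recurrence, whence \<open>\<psi>\<^sub>n = L\<^sub>m(u\<^sup>2) / u ^ (2 * m + 1)\<close>, where
  \<open>L\<^sub>m(v) = (\<Sum>k\<le>m. c\<^sub>k * c\<^sub>m\<^sub>-\<^sub>k * v ^ k)\<close> and \<open>c\<^sub>k\<close> are the coefficients of
  \<open>(1 - v) powr (-1/2)\<close>. As for orthogonal polynomials, the recurrence forces
  \<open>(u + 1 / u) / 2\<close> to be real at a zero; since \<open>L\<^sub>m > 0\<close> on the nonnegative reals, this means
  \<open>\<bar>u\<bar> = 1\<close>, so that all zeros lie exactly on the circle. The coefficient of \<open>u ^ k\<close> in
  \<open>L\<^sub>m(u\<^sup>2) / c\<^sub>m\<close> is at most \<open>2 ^ k\<close>, so by Newton's identities the power sums of the \<open>2 * m\<close> zeros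
  \<open>u\<close> are bounded independently of \<open>m\<close>, and Weyl's criterion gives equidistribution.
\<close>

section \<open>Taylor coefficients of \<open>(1 - v) powr (-1/2)\<close>: ratios and bounds\<close>

primrec central :: "nat \<Rightarrow> real" where
  "central 0 = 1"
| "central (Suc k) = (2 * real k + 1) * central k / (2 * real k + 2)"

declare central.simps(2) [simp del]

lemmas central_Suc = central.simps(2)

text \<open>The generic coefficient of the recurrence for \<open>legpoly\<close>: \<open>A\<close>,
  \<open>A'\<close> stand for \<open>central\<close> at \<open>j\<close>, \<open>j + 1\<close> with
  \<open>x = j + 1\<close>, and \<open>B\<close>, \<open>B'\<close>, \<open>y\<close> likewise.
  Splitting \<open>x + y\<close> on the left and inserting both ratio relations proves it.\<close>

lemma central_algebra:
  fixes x y A A' B B' :: real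
  assumes "2 * x * A' = (2 * x - 1) * A" "2 * y * B' = (2 * y - 1) * B"
  shows "2 * (x + y) * (A' * B') = (2 * (x + y) - 1) * (A' * B + A * B') - 2 * (x + y - 1) * (A * B)"
  using assms by algebra

lemma central_Suc': "2 * (real k + 1) * central (Suc k) = (2 * (real k + 1) - 1) * central k"
proof -
  have "2 * real k + 2 \<noteq> 0" by linarith
  then have "(2 * real k + 2) * central (Suc k) = (2 * real k + 1) * central k"
    by (simp only: central_Suc times_divide_eq_right nonzero_mult_div_cancel_left not_False_eq_True)
  then show ?thesis by (simp add: algebra_simps)
qed

lemma central_Suc_eq: "real (Suc k) * central (Suc k) = real (2 * k + 1) / 2 * central k"
  using central_Suc'[of k] by (simp add: algebra_simps)

lemma central_pos: "central k > 0"
  by (induction k) (auto simp: central_Suc intro!: divide_pos_pos mult_pos_pos)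

lemma central_Suc_le: "central (Suc k) \<le> central k"
  unfolding central_Suc using central_pos[of k]
  by (intro divide_le_eq[THEN iffD2]) (auto simp: algebra_simps)

lemma central_le_1: "central k \<le> 1"
  using lift_Suc_antimono_le[of central 0 k] central_Suc_le by simp

lemma central_le_double_Suc: "central k \<le> 2 * central (Suc k)"
proof -
  have "(2 * (real k + 1)) * central k \<le> (2 * (2 * (real k + 1) - 1)) * central k"
    using less_imp_le[OF central_pos] by (intro mult_right_mono) auto
  also have "\<dots> = (2 * (real k + 1)) * (2 * central (Suc k))"
    using central_Suc'[of k] by (simp only: mult_ac)
  finally have "(2 * (real k + 1)) * central k \<le> (2 * (real k + 1)) * (2 * central (Suc k))" .
  then show ?thesis by (subst (asm) mult_le_cancel_left_pos) auto
qed

text \<open>Consecutive values have ratio \<open>(2 * k + 1) / (2 * k + 2)\<close>, which is at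
  least 1/2. This rate does not depend on the index, which later makes the power sum bounds uniform
  in the degree.\<close>

lemma central_le_double: "central k \<le> 2 ^ j * central (k + j)"
proof (induction j)
  case (Suc j)
  have "central (k + j) \<le> 2 * central (Suc (k + j))" by (rule central_le_double_Suc)
  then have "2 ^ j * central (k + j) \<le> 2 ^ j * (2 * central (Suc (k + j)))"
    by (intro mult_left_mono) auto
  with Suc have "central k \<le> 2 ^ j * (2 * central (Suc (k + j)))" by (rule order.trans)
  then show ?case by (simp add: mult.assoc mult.left_commute)
qed simp

section \<open>Legendre polynomials in the variable \<open>v = u ^ 2\<close>\<close>

text \<open>
  In terms of the Legendre polynomials, \<open>poly (legpoly m) (u\<^sup>2) = u ^ m * P\<^sub>m ((u + 1 / u) / 2)\<close>.
\<close>
definition legpoly :: "nat \<Rightarrow> complex poly" where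
  "legpoly m = (\<Sum>k\<le>m. monom (of_real (central k * central (m - k))) k)"

lemma coeff_legpoly:
  "coeff (legpoly m) k = (if k \<le> m then of_real (central k * central (m - k)) else 0)"
  by (simp add: legpoly_def coeff_sum)

lemma legpoly_0 [simp]: "legpoly 0 = 1"
  by (simp add: legpoly_def)

text \<open>Bonnet's recurrence
  \<open>(m + 1) * P (m + 1) = (2 * m + 1) * z * P m - m * P (m - 1)\<close> at
  \<open>z = (u + 1 / u) / 2\<close>, multiplied by \<open>u ^ (m + 1)\<close>. The truncated
  \<open>m - 1\<close> at \<open>m = 0\<close> is harmless because its factor is 0.\<close>

lemma legpoly_Suc:
  "smult (of_nat (Suc m)) (legpoly (Suc m)) =
     smult (of_nat (2 * m + 1) / 2) ([:1, 1:] * legpoly m) - smult (of_nat m) ([:0, 1:] * legpoly (m - 1))"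
proof (rule poly_eqI)
  fix k
  have main: "real (Suc m) * (if k \<le> Suc m then central k * central (Suc m - k) else 0) =
    real (2 * m + 1) / 2 * ((if k \<le> m then central k * central (m - k) else 0) +
      (case k of 0 \<Rightarrow> 0 | Suc j \<Rightarrow> if j \<le> m then central j * central (m - j) else 0))
    - real m * (case k of 0 \<Rightarrow> 0 | Suc j \<Rightarrow> if j \<le> m - 1 then central j * central (m - 1 - j) else 0)"
  proof (cases k)
    case 0
    have "real (Suc m) * central (Suc m) = real (2 * m + 1) / 2 * central m"
      by (rule central_Suc_eq)
    with 0 show ?thesis by simp
  next
    case k: (Suc j)
    \<comment> \<open>The order \<open>k = Suc j\<close> lies above the degree, at the leading
      coefficient, or in the interior; there \<open>central_algebra\<close> applies with
      \<open>x + y = m + 1\<close>.\<close>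
    consider "j > m" | "j = m" | i where "m = Suc (j + i)"
      by (metis less_imp_Suc_add linorder_neqE_nat)
    then show ?thesis
    proof cases
      case 1
      then show ?thesis by (simp add: k)
    next
      case 2
      have "real (Suc m) * central (Suc m) = real (2 * m + 1) / 2 * central m"
        by (rule central_Suc_eq)
      \<comment> \<open>For \<open>m = 0\<close> the test \<open>j \<le> m - 1\<close> succeeds by
        truncation, but then the factor \<open>real m\<close> vanishes.\<close>
      then show ?thesis using 2 by (cases m) (simp_all add: k)
    next
      case (3 i)
      have if1: "(if k \<le> Suc m then central k * central (Suc m - k) else 0) = central (Suc j) * central (Suc i)"
        "(if k \<le> m then central k * central (m - k) else 0) = central (Suc j) * central i"
        "(if j \<le> m then central j * central (m - j) else 0) = central j * central (Suc i)"
        "(if j \<le> m - 1 then central j * central (m - 1 - j) else 0) = central j * central i"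
        using 3 k by auto
      have "2 * ((real j + 1) + (real i + 1)) * (central (Suc j) * central (Suc i)) =
          (2 * ((real j + 1) + (real i + 1)) - 1) * (central (Suc j) * central i + central j * central (Suc i))
          - 2 * ((real j + 1) + (real i + 1) - 1) * (central j * central i)"
        by (rule central_algebra) (rule central_Suc')+
      then show ?thesis
        unfolding if1 unfolding k nat.case if1 by (simp add: 3 algebra_simps)
    qed
  qed
  have "coeff (smult (of_nat (Suc m)) (legpoly (Suc m))) k = of_real (real (Suc m) *
      (if k \<le> Suc m then central k * central (Suc m - k) else 0))"
    by (simp add: coeff_legpoly del: of_nat_Suc)
  also note main
  also have "of_real (real (2 * m + 1) / 2 * ((if k \<le> m then central k * central (m - k) else 0) +
      (case k of 0 \<Rightarrow> 0 | Suc j \<Rightarrow> if j \<le> m then central j * central (m - j) else 0))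
    - real m * (case k of 0 \<Rightarrow> 0 | Suc j \<Rightarrow> if j \<le> m - 1 then central j * central (m - 1 - j) else 0)) =
    coeff (smult (of_nat (2 * m + 1) / 2) ([:1, 1:] * legpoly m) - smult (of_nat m) ([:0, 1:] * legpoly (m - 1))) k"
    by (cases k) (simp_all add: coeff_legpoly mult_pCons_left)
  finally show "coeff (smult (of_nat (Suc m)) (legpoly (Suc m))) k =
    coeff (smult (of_nat (2 * m + 1) / 2) ([:1, 1:] * legpoly m) - smult (of_nat m) ([:0, 1:] * legpoly (m - 1))) k" .
qed

lemma poly_legpoly_Suc:
  "of_nat (Suc m) * poly (legpoly (Suc m)) v =
     of_nat (2 * m + 1) * ((1 + v) / 2) * poly (legpoly m) v - of_nat m * v * poly (legpoly (m - 1)) v"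
  using arg_cong[OF legpoly_Suc[of m], of "\<lambda>p. poly p v"]
  by (simp add: algebra_simps del: of_nat_Suc)

lemma degree_legpoly: "degree (legpoly m) = m"
proof (rule antisym)
  show "degree (legpoly m) \<le> m" by (rule degree_le) (simp add: coeff_legpoly)
  show "m \<le> degree (legpoly m)"
    by (rule le_degree) (use central_pos[of m] in \<open>simp add: coeff_legpoly\<close>)
qed

text \<open>All coefficients are positive. This excludes real \<open>u\<close> at a zero, since then
  \<open>u ^ 2 \<ge> 0\<close>, and it keeps the numerator of \<open>psi\<close> from vanishing at
  \<open>u = 0\<close>.\<close>

lemma poly_legpoly_of_real_pos:
  assumes "x \<ge> 0"
  obtains r where "poly (legpoly m) (of_real x) = of_real r" "r > 0"
proof
  show "poly (legpoly m) (of_real x) = of_real (\<Sum>k\<le>m. central k * central (m - k) * x ^ k)"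
    by (simp add: legpoly_def poly_sum poly_monom)
  have "0 < central 0 * central (m - 0) * x ^ 0" using central_pos by simp
  also have "\<dots> \<le> (\<Sum>k\<le>m. central k * central (m - k) * x ^ k)"
    using assms by (intro member_le_sum) (auto intro!: mult_nonneg_nonneg less_imp_le[OF central_pos])
  finally show "(\<Sum>k\<le>m. central k * central (m - k) * x ^ k) > 0" .
qed

section \<open>Zeros on the unit circle\<close>

text \<open>
  With \<open>P k = legpoly k (u\<^sup>2) / u ^ k\<close>, the recurrence is that of the Legendre polynomials at
  \<open>z = (u + 1 / u) / 2\<close>; taking imaginary parts after multiplication by the conjugate of \<open>P k\<close>
  gives a telescoping sum.
\<close>
lemma legpoly_root_unit:
  assumes root: "poly (legpoly m) (u\<^sup>2) = 0"
  shows "norm u = 1"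
proof (cases "u = 0")
  case True
  then show ?thesis using root poly_legpoly_of_real_pos[of 0 m]
    by (metis less_numeral_extra(3) of_real_0 of_real_eq_0_iff order_refl power_zero_numeral)
next
  case u: False
  define z where "z = (u + 1 / u) / 2"
  define P where "P k = poly (legpoly k) (u\<^sup>2) / u ^ k" for k
  have rec: "of_nat (Suc k) * P (Suc k) = of_nat (2 * k + 1) * z * P k - of_nat k * P (k - 1)" for k
  proof -
    have k: "of_nat k * poly (legpoly (k - 1)) (u\<^sup>2) * u\<^sup>2 / u ^ Suc k = of_nat k * P (k - 1)"
      using u by (cases k) (simp_all add: P_def power2_eq_square)
    have "of_nat (Suc k) * P (Suc k) = (of_nat (Suc k) * poly (legpoly (Suc k)) (u\<^sup>2)) / u ^ Suc k"
      by (simp add: P_def)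
    also have "\<dots> = of_nat (2 * k + 1) * ((1 + u\<^sup>2) / 2) * poly (legpoly k) (u\<^sup>2) / u ^ Suc k
       - of_nat k * poly (legpoly (k - 1)) (u\<^sup>2) * u\<^sup>2 / u ^ Suc k"
      unfolding poly_legpoly_Suc by (simp add: diff_divide_distrib mult_ac)
    also have "of_nat (2 * k + 1) * ((1 + u\<^sup>2) / 2) * poly (legpoly k) (u\<^sup>2) / u ^ Suc k =
       of_nat (2 * k + 1) * z * P k"
    proof -
      have "(1 + u\<^sup>2) / 2 = z * u" using u by (simp add: z_def power2_eq_square algebra_simps)
      then show ?thesis using u by (simp add: P_def)
    qed
    finally show ?thesis unfolding k .
  qed
  \<comment> \<open>A discrete Wronskian: \<open>W (Suc k) - W k\<close> equals
    \<open>Im z * (2 * k + 3) * norm (P (Suc k)) ^ 2\<close>, because moving the conjugation to the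
    other factor flips the imaginary part.\<close>
  define W where "W k = real (Suc k) * Im (P (Suc k) * cnj (P k))" for k
  have W: "W k = Im z * (\<Sum>j\<le>k. real (2 * j + 1) * (norm (P j))\<^sup>2)" for k
  proof (induction k)
    case 0
    show ?case using rec[of 0] by (simp add: W_def P_def)
  next
    case (Suc k)
    have "W (Suc k) = Im ((of_nat (Suc (Suc k)) * P (Suc (Suc k))) * cnj (P (Suc k)))"
      by (simp add: W_def algebra_simps)
    also have "\<dots> = Im (of_nat (2 * Suc k + 1) * (z * (P (Suc k) * cnj (P (Suc k))))
        - of_nat (Suc k) * (P k * cnj (P (Suc k))))"
      unfolding rec by (simp add: algebra_simps)
    also have "\<dots> = real (2 * Suc k + 1) * (Im z * (norm (P (Suc k)))\<^sup>2) - real (Suc k) * Im (P k * cnj (P (Suc k)))"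
      unfolding complex_norm_square[symmetric]
      by (simp add: algebra_simps del: of_real_power)
    also have "Im (P k * cnj (P (Suc k))) = - Im (P (Suc k) * cnj (P k))" by simp
    also have "real (Suc k) * - Im (P (Suc k) * cnj (P k)) = - W k" unfolding W_def by (rule mult_minus_right)
    finally show ?case by (simp add: Suc algebra_simps)
  qed
  have P0: "P 0 = 1" by (simp add: P_def)
  have Pm: "P m = 0" using root by (simp add: P_def)
  then obtain n where m: "m = Suc n" using P0 by (cases m) auto
  have "W n = 0" using Pm by (simp add: W_def m)
  \<comment> \<open>The term \<open>j = 0\<close> is 1, so the sum is positive and
    \<open>W n = 0\<close> forces \<open>Im z = 0\<close>.\<close>
  moreover have "(\<Sum>j\<le>n. real (2 * j + 1) * (norm (P j))\<^sup>2) \<ge> real (2 * 0 + 1) * (norm (P 0))\<^sup>2"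
    by (rule member_le_sum) auto
  ultimately have "Im z = 0" using W[of n] P0 by auto
  then have "Im (u + 1 / u) = 0" by (simp add: z_def)
  \<comment> \<open>Since \<open>Im (1 / u) = - Im u / norm u ^ 2\<close>, a real
    \<open>u + 1 / u\<close> means that \<open>u\<close> is real or on the unit circle.\<close>
  then have "Im u = Im u / (norm u)\<^sup>2"
    by (simp add: Im_divide cmod_power2)
  then have "Im u * (norm u)\<^sup>2 = Im u"
    using u by (metis nonzero_eq_divide_eq norm_eq_zero power_not_zero)
  moreover have "Im u \<noteq> 0"
  proof
    assume "Im u = 0"
    then have "u\<^sup>2 = of_real ((Re u)\<^sup>2)" by (simp add: complex_eq_iff power2_eq_square)
    with root show False using poly_legpoly_of_real_pos[of "(Re u)\<^sup>2" m]
      by (metis less_numeral_extra(3) of_real_eq_0_iff zero_le_power2)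
  qed
  ultimately have "(norm u)\<^sup>2 = 1" by simp
  then show ?thesis by (simp add: power2_eq_1_iff) (use norm_ge_zero[of u] in linarith)
qed

section \<open>Recurrence for the series of squared binomial coefficients\<close>

lemma inverse_fact_Suc: "inverse (fact n) = of_nat (Suc n) * inverse (fact (Suc n) :: 'a :: field_char_0)"
proof -
  have "inverse (fact (Suc n) :: 'a) = inverse (of_nat (Suc n)) * inverse (fact n)"
    by (simp only: fact_Suc inverse_mult_distrib)
  moreover have "(of_nat (Suc n) :: 'a) \<noteq> 0" by (rule of_nat_neq_0)
  ultimately show ?thesis by (simp del: of_nat_Suc add: mult.assoc[symmetric])
qed

lemma binomial_add_fact:
  "(of_nat ((m + k) choose k) :: 'a :: field_char_0) = fact (m + k) * inverse (fact k) * inverse (fact m)"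
  by (simp add: binomial_fact divide_inverse mult.assoc)

text \<open>The coefficient of \<open>t ^ (k + 2)\<close> in the series recurrence below. After
  division by a common factor it is a polynomial identity in \<open>m\<close> and
  \<open>k\<close>.\<close>

lemma squared_binomial_recurrence:
  fixes a :: "nat \<Rightarrow> nat \<Rightarrow> complex"
  defines "a \<equiv> \<lambda>m k. (of_nat ((m + k) choose k))\<^sup>2"
  shows "of_nat (Suc m) * (a (Suc m) (Suc (Suc k)) - 2 * a (Suc m) (Suc k) + a (Suc m) k) =
    of_nat (2 * m + 1) * (a m (Suc (Suc k)) + a m (Suc k)) - of_nat m * a (m - 1) (Suc (Suc k))"
proof -
  define M K :: complex where "M = of_nat m" and "K = of_nat k"
  \<comment> \<open>The smallest numerator over the largest denominators that occur, so every
    binomial coefficient here is a polynomial multiple of \<open>w\<close>.\<close>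
  define w :: complex where "w = fact (Suc (m + k)) * inverse (fact (Suc m)) * inverse (fact (Suc (Suc k)))"
  have ik: "inverse (fact k :: complex) = (K + 1) * ((K + 2) * inverse (fact (Suc (Suc k))))"
    using inverse_fact_Suc[of k, where 'a = complex] inverse_fact_Suc[of "Suc k", where 'a = complex]
    by (simp only: K_def of_nat_Suc) (simp add: add_ac)
  have ik1: "inverse (fact (Suc k) :: complex) = (K + 2) * inverse (fact (Suc (Suc k)))"
    using inverse_fact_Suc[of "Suc k", where 'a = complex]
    by (simp only: K_def of_nat_Suc) (simp add: add_ac)
  have im: "inverse (fact m :: complex) = (M + 1) * inverse (fact (Suc m))"
    using inverse_fact_Suc[of m, where 'a = complex] by (simp only: M_def of_nat_Suc add_ac)
  have f2: "fact (Suc (Suc (m + k))) = (M + K + 2) * (fact (Suc (m + k)) :: complex)"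
    by (simp only: fact_Suc[of "Suc (m + k)"] M_def K_def) simp
  have f3: "fact (Suc (Suc (Suc (m + k)))) = (M + K + 3) * ((M + K + 2) * (fact (Suc (m + k)) :: complex))"
    unfolding f2[symmetric] by (simp only: fact_Suc[of "Suc (Suc (m + k))"] M_def K_def) simp
  have b0: "a (Suc m) k = ((K + 1) * (K + 2) * w)\<^sup>2"
    unfolding a_def binomial_add_fact ik w_def add_Suc_right add_Suc by (simp only: mult_ac)
  have b1: "a (Suc m) (Suc k) = ((M + K + 2) * (K + 2) * w)\<^sup>2"
    unfolding a_def binomial_add_fact ik1 w_def add_Suc_right add_Suc f2 by (simp only: mult_ac)
  have b2: "a (Suc m) (Suc (Suc k)) = ((M + K + 3) * (M + K + 2) * w)\<^sup>2"
    unfolding a_def binomial_add_fact w_def add_Suc_right add_Suc f3 by (simp only: mult_ac)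
  have c1: "a m (Suc k) = ((M + 1) * (K + 2) * w)\<^sup>2"
    unfolding a_def binomial_add_fact w_def add_Suc_right add_Suc ik1 im by (simp only: mult_ac)
  have c2: "a m (Suc (Suc k)) = ((M + K + 2) * (M + 1) * w)\<^sup>2"
    unfolding a_def binomial_add_fact w_def add_Suc_right add_Suc f2 im by (simp only: mult_ac)
  \<comment> \<open>Keeping the factor \<open>M\<close> covers \<open>m = 0\<close>, where
    \<open>m - 1\<close> is truncated.\<close>
  have d: "M * a (m - 1) (Suc (Suc k)) = M * (M * (M + 1) * w)\<^sup>2"
  proof (cases m)
    case (Suc p)
    have ip: "inverse (fact p :: complex) = M * inverse (fact (Suc p))"
      using inverse_fact_Suc[of p, where 'a = complex] by (simp only: M_def Suc)
    have "a p (Suc (Suc k)) = (M * (M + 1) * w)\<^sup>2"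
      unfolding a_def binomial_add_fact w_def add_Suc_right add_Suc ip im[unfolded Suc] Suc by (simp only: mult_ac)
    then show ?thesis by (simp add: Suc)
  qed (simp add: M_def)
  have "(M + 1) * (((M + K + 3) * (M + K + 2) * w)\<^sup>2 - 2 * ((M + K + 2) * (K + 2) * w)\<^sup>2 + ((K + 1) * (K + 2) * w)\<^sup>2)
    = (2 * M + 1) * (((M + K + 2) * (M + 1) * w)\<^sup>2 + ((M + 1) * (K + 2) * w)\<^sup>2) - M * (M * (M + 1) * w)\<^sup>2"
    by algebra
  then show ?thesis unfolding b0 b1 b2 c1 c2 d[unfolded M_def] by (simp add: M_def add_ac)
qed

lemma sums_shift:
  fixes f :: "nat \<Rightarrow> 'a :: real_normed_vector"
  assumes "f sums s"
  shows "(\<lambda>k. case k of 0 \<Rightarrow> 0 | Suc j \<Rightarrow> f j) sums s"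
  using sums_Suc[of "\<lambda>k. case k of 0 \<Rightarrow> 0 | Suc j \<Rightarrow> f j" s] assms by simp

text \<open>For \<open>(1 - t) ^ (m + 1) * F m\<close> this becomes Bonnet's recurrence at
  \<open>(1 + t) / (1 - t)\<close>.\<close>

lemma squared_binomial_series_recurrence:
  fixes a :: "nat \<Rightarrow> nat \<Rightarrow> complex"
  defines "a \<equiv> \<lambda>m k. (of_nat ((m + k) choose k))\<^sup>2"
  assumes t: "norm t < 1"
  defines "F \<equiv> \<lambda>m. \<Sum>k. a m k * t ^ k"
  shows "of_nat (Suc m) * (1 - t)\<^sup>2 * F (Suc m) = of_nat (2 * m + 1) * (1 + t) * F m - of_nat m * F (m - 1)"
proof -
  have F: "(\<lambda>k. a m k * t ^ k) sums F m" for m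
    using sums_rational[of m] t unfolding a_def F_def by (auto simp: sums_iff)
  \<comment> \<open>Shifting the terms multiplies the sum by \<open>t\<close>, so the recurrence can
    be checked term by term.\<close>
  define sh where "sh f = (\<lambda>k. case k of 0 \<Rightarrow> 0 | Suc j \<Rightarrow> f j * t)" for f :: "nat \<Rightarrow> complex"
  have sh: "sh f sums (s * t)" if "f sums s" for f s
    unfolding sh_def using sums_shift[OF sums_mult2[OF that, of t]] .
  define f where "f = (\<lambda>m k. a m k * t ^ k)"
  have f: "f m sums F m" for m using F by (simp add: f_def)
  have "(\<lambda>k. of_nat (Suc m) * (f (Suc m) k - 2 * sh (f (Suc m)) k + sh (sh (f (Suc m))) k))
     sums (of_nat (Suc m) * (F (Suc m) - 2 * (F (Suc m) * t) + F (Suc m) * t * t))"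
    by (intro sums_mult sums_add sums_diff sh f)
  moreover have "(\<lambda>k. of_nat (2 * m + 1) * (f m k + sh (f m) k) - of_nat m * f (m - 1) k)
     sums (of_nat (2 * m + 1) * (F m + F m * t) - of_nat m * F (m - 1))"
    by (intro sums_mult sums_add sums_diff sh f)
  moreover have "of_nat (Suc m) * (f (Suc m) k - 2 * sh (f (Suc m)) k + sh (sh (f (Suc m))) k) =
     of_nat (2 * m + 1) * (f m k + sh (f m) k) - of_nat m * f (m - 1) k" for k
  proof -
    \<comment> \<open>Orders 0 and 1 involve the default 0 of the shift; from order 2 on,
      \<open>squared_binomial_recurrence\<close> applies.\<close>
    consider "k = 0" | "k = 1" | j where "k = Suc (Suc j)"
      by (metis One_nat_def not0_implies_Suc)
    then show ?thesis
    proof cases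
      case 1
      then show ?thesis by (simp add: f_def sh_def a_def)
    next
      case 2
      then show ?thesis
        by (cases m) (simp_all add: f_def sh_def a_def power2_eq_square algebra_simps)
    next
      case (3 j)
      have "of_nat (Suc m) * (f (Suc m) k - 2 * sh (f (Suc m)) k + sh (sh (f (Suc m))) k) =
        (of_nat (Suc m) * (a (Suc m) (Suc (Suc j)) - 2 * a (Suc m) (Suc j) + a (Suc m) j)) * t ^ k"
        by (simp add: f_def sh_def 3 algebra_simps del: of_nat_Suc)
      also have "\<dots> = (of_nat (2 * m + 1) * (a m (Suc (Suc j)) + a m (Suc j))
          - of_nat m * a (m - 1) (Suc (Suc j))) * t ^ k"
        unfolding a_def squared_binomial_recurrence ..
      also have "\<dots> = of_nat (2 * m + 1) * (f m k + sh (f m) k) - of_nat m * f (m - 1) k"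
        by (simp add: f_def sh_def 3 algebra_simps)
      finally show ?thesis .
    qed
  qed
  ultimately have "of_nat (Suc m) * (F (Suc m) - 2 * (F (Suc m) * t) + F (Suc m) * t * t) =
     of_nat (2 * m + 1) * (F m + F m * t) - of_nat m * F (m - 1)"
    by (simp only: sums_unique2)
  then show ?thesis by (simp add: power2_eq_square algebra_simps del: of_nat_Suc)
qed

section \<open>Closed form of \<open>psi\<close>\<close>

text \<open>With \<open>u = 1 + 2 * z\<close> the two Legendre arguments agree:
  \<open>(1 + t) / (1 - t) = (u + 1 / u) / 2\<close>. Both sides then obey the same recurrence with
  the same initial value.\<close>

lemma squared_binomial_sums_legpoly:
  assumes x: "x \<ge> 0"
  defines "z \<equiv> complex_of_real x"
  shows "(\<lambda>k. (of_nat ((m + k) choose k))\<^sup>2 * ((z / (1 + z))\<^sup>2) ^ k) sums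
           (poly (legpoly m) ((1 + 2 * z)\<^sup>2) * (1 + z) ^ (2 * m + 2) / (1 + 2 * z) ^ (2 * m + 1))"
proof -
  define t where "t = (z / (1 + z))\<^sup>2"
  define u where "u = 1 + 2 * z"
  define w where "w = (1 + z)\<^sup>2"
  have "1 + z = complex_of_real (1 + x)" "u = complex_of_real (1 + 2 * x)"
    by (simp_all add: z_def u_def)
  moreover have "1 + x \<noteq> 0" "1 + 2 * x \<noteq> 0" using x by auto
  ultimately have z1: "1 + z \<noteq> 0" and u: "u \<noteq> 0" by (simp_all only: of_real_eq_0_iff not_False_eq_True)
  have w: "w \<noteq> 0" using z1 by (simp add: w_def)
  have "(x / (1 + x))\<^sup>2 < 1" using x by (intro power_less_one_iff[THEN iffD2]) auto
  moreover have "t = complex_of_real ((x / (1 + x))\<^sup>2)" by (simp add: t_def z_def)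
  ultimately have t: "norm t < 1" by (simp only: norm_of_real) auto
  have tz: "t * w = z\<^sup>2" using z1 by (simp add: t_def w_def power_divide)
  have t1: "(1 - t) * w = u" and t2: "(1 + t) * w = (1 + u\<^sup>2) / 2"
    by (simp_all add: left_diff_distrib distrib_right tz) 
      (simp_all add: w_def u_def power2_eq_square algebra_simps)
  define F where "F m = (\<Sum>k. (of_nat ((m + k) choose k))\<^sup>2 * t ^ k)" for m
  define L where "L m = poly (legpoly m) (u\<^sup>2)" for m
  \<comment> \<open>Multiplication by \<open>w\<close> turns \<open>1 - t\<close> and
    \<open>1 + t\<close> into polynomials in \<open>u\<close>. The recurrence reaches two steps
    back, hence strong induction.\<close>
  have claim: "F m * u ^ (2 * m + 1) = L m * w ^ Suc m" for m
  proof (induction m rule: less_induct)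
    case (less m)
    show ?case
    proof (cases m)
      case 0
      have "F 0 = 1 / (1 - t)" unfolding F_def using geometric_sums[OF t] by (simp add: sums_iff)
      moreover have "1 - t \<noteq> 0" using t by auto
      ultimately show ?thesis by (simp add: 0 L_def t1[symmetric])
    next
      case (Suc n)
      have IH: "F n * u ^ (2 * n + 1) = L n * w ^ Suc n" using less Suc by simp
      have IH': "of_nat n * F (n - 1) * u ^ (2 * n + 1) = of_nat n * (L (n - 1) * w ^ n * u\<^sup>2)"
      proof (cases n)
        case (Suc p)
        have "F p * u ^ (2 * p + 1) = L p * w ^ Suc p" using less \<open>m = Suc n\<close> Suc by simp
        moreover have "u ^ (2 * n + 1) = u ^ (2 * p + 1) * u\<^sup>2"
          by (simp add: Suc power2_eq_square)
        ultimately have "F p * u ^ (2 * n + 1) = L p * w ^ n * u\<^sup>2"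
          by (simp only: Suc mult.assoc[symmetric])
        then show ?thesis by (simp only: Suc diff_Suc_1 mult.assoc)
      qed simp
      have rF: "of_nat (Suc n) * (1 - t)\<^sup>2 * F (Suc n) =
          of_nat (2 * n + 1) * (1 + t) * F n - of_nat n * F (n - 1)"
        unfolding F_def by (rule squared_binomial_series_recurrence[OF t])
      have rL: "of_nat (Suc n) * L (Suc n) =
          of_nat (2 * n + 1) * ((1 + u\<^sup>2) / 2) * L n - of_nat n * u\<^sup>2 * L (n - 1)"
        unfolding L_def by (rule poly_legpoly_Suc)
      have "of_nat (Suc n) * (F (Suc n) * u ^ (2 * Suc n + 1)) =
          (of_nat (Suc n) * (1 - t)\<^sup>2 * F (Suc n)) * w\<^sup>2 * u ^ (2 * n + 1)"
        unfolding t1[symmetric] by (simp add: power_mult_distrib power2_eq_square mult_ac del: of_nat_Suc)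
      also have "\<dots> = of_nat (2 * n + 1) * ((1 + t) * w) * (F n * u ^ (2 * n + 1)) * w
          - (of_nat n * F (n - 1) * u ^ (2 * n + 1)) * w\<^sup>2"
        unfolding rF by (simp only: left_diff_distrib right_diff_distrib power2_eq_square mult_ac)
      also have "\<dots> = (of_nat (2 * n + 1) * ((1 + u\<^sup>2) / 2) * L n - of_nat n * u\<^sup>2 * L (n - 1)) * w ^ Suc (Suc n)"
        unfolding IH IH' t2 by (simp only: left_diff_distrib right_diff_distrib power2_eq_square power_Suc mult_ac)
      also have "\<dots> = of_nat (Suc n) * (L (Suc n) * w ^ Suc (Suc n))"
        unfolding rL[symmetric] by (simp only: mult_ac)
      finally show ?thesis unfolding Suc by (simp only: mult_cancel_left of_nat_neq_0 simp_thms)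
    qed
  qed
  have "F m = L m * w ^ Suc m / u ^ (2 * m + 1)"
    using claim[of m] u by (metis nonzero_eq_divide_eq power_not_zero)
  also have "w ^ Suc m = (1 + z) ^ (2 * m + 2)"
    unfolding w_def power_mult[symmetric] by simp
  finally have "F m = L m * (1 + z) ^ (2 * m + 2) / u ^ (2 * m + 1)" .
  moreover have "(\<lambda>k. (of_nat ((m + k) choose k))\<^sup>2 * t ^ k) sums F m"
    using sums_rational[of m] t unfolding F_def by (auto simp: sums_iff)
  ultimately show ?thesis by (simp only: L_def t_def u_def)
qed

definition psi_num :: "nat \<Rightarrow> complex poly" where
  "psi_num m = pcompose (legpoly m) ([:1, 2:]\<^sup>2)"

lemma poly_psi_num: "poly (psi_num m) z = poly (legpoly m) ((1 + 2 * z)\<^sup>2)"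
  by (simp add: psi_num_def poly_pcompose mult.commute)

lemma degree_psi_num: "degree (psi_num m) = 2 * m"
  by (simp add: psi_num_def degree_pcompose degree_legpoly degree_power_eq)

text \<open>The power of \<open>1 + z\<close> from the series cancels the one in
  \<open>baskakov_sq\<close>, leaving \<open>u = 0\<close> as the only candidate for a pole.
  Uniqueness in \<open>ex1_psi\<close> then resolves the \<open>THE\<close>.\<close>

lemma psi_Suc: "psi (Suc m) = Fract (psi_num m) ([:1, 2:] ^ (2 * m + 1))"
proof -
  have "(\<lambda>k. complex_of_real ((baskakov (Suc m) k x)\<^sup>2)) sums
      ratfun_eval (Fract (psi_num m) ([:1, 2:] ^ (2 * m + 1))) (complex_of_real x)" if x: "x \<ge> 0" for x
  proof -
    define z where "z = complex_of_real x"
    have "1 + z = complex_of_real (1 + x)" "1 + 2 * z = complex_of_real (1 + 2 * x)"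
      by (simp_all add: z_def)
    moreover have "1 + x \<noteq> 0" "1 + 2 * x \<noteq> 0" using x by auto
    ultimately have z1: "1 + z \<noteq> 0" "1 + 2 * z \<noteq> 0" by (simp_all only: of_real_eq_0_iff not_False_eq_True)
    have "complex_of_real ((baskakov (Suc m) k x)\<^sup>2) =
        (of_nat ((m + k) choose k))\<^sup>2 * ((z / (1 + z))\<^sup>2) ^ k / (1 + z) ^ (2 * m + 2)" for k
      unfolding baskakov_sq[OF x] by (simp add: z_def)
    then have "(\<lambda>k. complex_of_real ((baskakov (Suc m) k x)\<^sup>2)) sums
        (poly (legpoly m) ((1 + 2 * z)\<^sup>2) * (1 + z) ^ (2 * m + 2) / (1 + 2 * z) ^ (2 * m + 1)
          / (1 + z) ^ (2 * m + 2))"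
      using sums_divide[OF squared_binomial_sums_legpoly[OF x, of m]] by (simp only: z_def)
    also have "\<dots> = poly (psi_num m) z / poly ([:1, 2:] ^ (2 * m + 1)) z"
      using z1 by (simp add: poly_psi_num mult.commute[of z] del: power_Suc)
    also have "\<dots> = ratfun_eval (Fract (psi_num m) ([:1, 2:] ^ (2 * m + 1))) z"
      using z1 by (subst ratfun_eval_Fract) (simp_all add: mult.commute[of z] del: power_Suc)
    finally show ?thesis by (simp only: z_def)
  qed
  then show ?thesis unfolding psi_def by (intro the1_equality ex1_psi) auto
qed

section \<open>Zeros of \<open>psi\<close> with multiplicity\<close>

text \<open>Reduction to lowest terms removes a common factor \<open>d\<close>; coprimality makes it
  a nonzero constant, which leaves the roots unchanged.\<close>

lemma ratfun_zeros_Fract: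
  assumes "coprime a b" "b \<noteq> 0"
  shows "ratfun_zeros (Fract a b) = proots a"
proof -
  have q: "quot_of_fract (Fract a b) = normalize_quot (a, b)"
    using quot_of_fract_quot_to_fract[of "(a, b)"] assms by (simp add: quot_to_fract_def)
  obtain d where d: "a = fst (normalize_quot (a,b)) * d" "b = snd (normalize_quot (a,b)) * d"
    using normalize_quotE[OF assms(2), of a] by metis
  then have "d dvd 1" using assms(1) by (metis coprime_common_divisor dvd_triv_right)
  then obtain c where c: "d = [:c:]" "c dvd 1" using is_unit_poly_iff by metis
  then have "c \<noteq> 0" by auto
  have "proots a = proots (fst (normalize_quot (a,b)))"
    by (subst d(1)) (use c \<open>c \<noteq> 0\<close> in simp)
  then show ?thesis by (simp add: ratfun_zeros_def q)
qed

lemma ratfun_zeros_psi: "ratfun_zeros (psi (Suc m)) = proots (psi_num m)"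
  unfolding psi_Suc
proof (rule ratfun_zeros_Fract)
  obtain r where "poly (legpoly m) (of_real 0) = of_real r" "r > 0"
    using poly_legpoly_of_real_pos[of 0 m] by blast
  \<comment> \<open>At \<open>u = 0\<close> the numerator is the positive constant term of
    \<open>legpoly m\<close>, so nothing cancels against the denominator.\<close>
  then have "poly (psi_num m) (- 1 / 2) \<noteq> 0" by (simp add: poly_psi_num)
  moreover have "poly (psi_num m) (- 1 / 2) = 0" if "[:1, 2:] dvd psi_num m"
    using that by (auto elim!: dvdE)
  ultimately have "coprime [:1, 2:] (psi_num m)"
    by (intro prime_elem_imp_coprime prime_elem_linear_field_poly) auto
  then show "coprime (psi_num m) ([:1, 2:] ^ (2 * m + 1))"
    by (subst coprime_power_right_iff) (simp add: coprime_commute)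
qed (simp del: power_Suc)

lemma psi_zero_norm:
  assumes "\<zeta> \<in># ratfun_zeros (psi (Suc m))"
  shows "norm (1 + 2 * \<zeta>) = 1"
proof -
  have "poly (psi_num m) \<zeta> = 0"
    using assms unfolding ratfun_zeros_psi by (cases "psi_num m = 0") auto
  then show ?thesis using legpoly_root_unit by (simp add: poly_psi_num)
qed

section \<open>Newton's identities and power sums\<close>

lemma fps_geometric_mult:
  "(1 - fps_const a * fps_X) * Abs_fps (\<lambda>j. a ^ Suc j) = fps_const (a :: 'a :: comm_ring_1)"
proof (rule fps_ext)
  fix n
  have "((1 - fps_const a * fps_X) * Abs_fps (\<lambda>j. a ^ Suc j)) $ n =
      a ^ Suc n - a * (fps_X * Abs_fps (\<lambda>j. a ^ Suc j)) $ n"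
    by (simp add: left_diff_distrib mult.assoc)
  also have "\<dots> = fps_const a $ n" by (cases n) auto
  finally show "((1 - fps_const a * fps_X) * Abs_fps (\<lambda>j. a ^ Suc j)) $ n = fps_const a $ n" .
qed

text \<open>The logarithmic derivative with denominators cleared: each factor contributes
  \<open>- a / (1 - a * X)\<close>, a geometric series whose coefficient at \<open>j\<close> is
  \<open>- (a ^ Suc j)\<close>.\<close>

lemma fps_deriv_prod_mset:
  fixes A :: "'a :: comm_ring_1 multiset"
  shows "fps_deriv (\<Prod>a\<in>#A. 1 - fps_const a * fps_X) =
    - (Abs_fps (\<lambda>j. \<Sum>a\<in>#A. a ^ Suc j) * (\<Prod>a\<in>#A. 1 - fps_const a * fps_X))"
proof (induction A)
  case empty
  have "Abs_fps (\<lambda>j. 0) = (0 :: 'a fps)" by (rule fps_ext) simp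
  then show ?case by simp
next
  case (add a A)
  define E where "E = (\<Prod>a\<in>#A. 1 - fps_const a * fps_X)"
  define G where "G = Abs_fps (\<lambda>j. \<Sum>a\<in>#A. a ^ Suc j)"
  define H where "H = Abs_fps (\<lambda>j. a ^ Suc j)"
  have s: "Abs_fps (\<lambda>j. \<Sum>b\<in>#add_mset a A. b ^ Suc j) = H + G"
    by (rule fps_ext) (simp add: H_def G_def)
  have "fps_deriv ((1 - fps_const a * fps_X) * E) = - (fps_const a * E) + (1 - fps_const a * fps_X) * fps_deriv E"
    by (simp add: algebra_simps)
  also have "fps_deriv E = - (G * E)" using add by (simp only: E_def G_def)
  also have "fps_const a * E = H * ((1 - fps_const a * fps_X) * E)"
    using fps_geometric_mult[of a] by (simp only: H_def mult_ac)
  finally have "fps_deriv ((1 - fps_const a * fps_X) * E) = - ((H + G) * ((1 - fps_const a * fps_X) * E))"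
    by (simp add: algebra_simps)
  then show ?case unfolding s by (simp add: E_def)
qed

lemma fps_of_poly_prod_mset:
  "fps_of_poly (\<Prod>a\<in>#A. [:1, - a:]) = (\<Prod>a\<in>#A. 1 - fps_const a * fps_X :: 'a :: comm_ring_1 fps)"
proof (induction A)
  case (add a A)
  have "fps_of_poly [:1, - a:] = 1 - fps_const a * fps_X"
    by (simp add: fps_of_poly_pCons fps_const_neg[symmetric] del: fps_const_neg)
  with add show ?case by (simp only: image_mset_add_mset prod_mset.add_mset fps_of_poly_mult)
qed simp

lemma newton_identity:
  fixes A :: "'a :: comm_ring_1 multiset"
  defines "e \<equiv> coeff (\<Prod>a\<in>#A. [:1, - a:])"
  shows "(\<Sum>a\<in>#A. a ^ Suc n) = - of_nat (Suc n) * e (Suc n) - (\<Sum>i<n. (\<Sum>a\<in>#A. a ^ Suc i) * e (n - i))"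
proof -
  have e: "(\<Prod>a\<in>#A. 1 - fps_const a * fps_X) $ k = e k" for k
    unfolding e_def fps_of_poly_prod_mset[symmetric] by simp
  have "e 0 = 1"
    unfolding e_def by (induction A) (auto simp: coeff_mult)
  moreover have "of_nat (Suc n) * e (Suc n) = - (\<Sum>i=0..n. (\<Sum>a\<in>#A. a ^ Suc i) * e (n - i))"
    using arg_cong[OF fps_deriv_prod_mset[of A], of "\<lambda>f. f $ n"]
    by (simp add: e fps_mult_nth del: of_nat_Suc power_Suc)
  \<comment> \<open>The convolution term \<open>i = n\<close> carries \<open>e 0 = 1\<close>; it is
    the power sum to be isolated.\<close>
  moreover have "{0..n} = insert n {..<n}" by auto
  ultimately show ?thesis by (simp del: of_nat_Suc power_Suc)
qed

lemma sum_powers_of_two: "(\<Sum>i<n. 2 ^ Suc i - 1 :: real) = 2 ^ Suc n - 2 - real n"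
  by (induction n) auto

text \<open>The bound is independent of the size of \<open>A\<close>. In Newton's identities all
  powers of \<open>r\<close> combine to \<open>r ^ Suc n\<close>, and \<open>2 ^ Suc n - 1\<close>
  solves the remaining recursion \<open>s n = (n + 1) + (\<Sum>i<n. s i)\<close>.\<close>

lemma norm_power_sum_le:
  fixes A :: "complex multiset"
  assumes e: "\<And>k. norm (coeff (\<Prod>a\<in>#A. [:1, - a:]) k) \<le> r ^ k" and r: "r \<ge> 0"
  shows "norm (\<Sum>a\<in>#A. a ^ Suc n) \<le> r ^ Suc n * (2 ^ Suc n - 1)"
proof (induction n rule: less_induct)
  case (less n)
  let ?e = "coeff (\<Prod>a\<in>#A. [:1, - a:])"
  have nonneg: "0 \<le> r ^ Suc i * (2 ^ Suc i - 1)" for i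
    using r one_le_power[of "2 :: real" "Suc i"] by (intro mult_nonneg_nonneg) auto
  have "norm (\<Sum>a\<in>#A. a ^ Suc n) \<le>
      norm (of_nat (Suc n) * ?e (Suc n)) + norm (\<Sum>i<n. (\<Sum>a\<in>#A. a ^ Suc i) * ?e (n - i))"
    unfolding newton_identity[of n A] using norm_triangle_ineq4[of "- of_nat (Suc n) * ?e (Suc n)"]
    by (simp only: mult_minus_left norm_minus_cancel)
  also have "norm (of_nat (Suc n) * ?e (Suc n)) \<le> real (Suc n) * r ^ Suc n"
    unfolding norm_mult norm_of_nat by (intro mult_left_mono e) auto
  also have "norm (\<Sum>i<n. (\<Sum>a\<in>#A. a ^ Suc i) * ?e (n - i)) \<le>
      (\<Sum>i<n. r ^ Suc i * (2 ^ Suc i - 1) * r ^ (n - i))"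
    unfolding norm_mult[symmetric]
    by (intro sum_norm_le) (unfold norm_mult, intro mult_mono less e nonneg, auto)
  also have "\<dots> = r ^ Suc n * (\<Sum>i<n. 2 ^ Suc i - 1)"
    unfolding sum_distrib_left
  proof (rule sum.cong[OF refl])
    fix i assume "i \<in> {..<n}"
    then have "r ^ Suc n = r ^ Suc i * r ^ (n - i)"
      by (simp only: power_add[symmetric]) simp
    then show "r ^ Suc i * (2 ^ Suc i - 1) * r ^ (n - i) = r ^ Suc n * (2 ^ Suc i - 1)"
      by (simp only: mult_ac)
  qed
  also have "real (Suc n) * r ^ Suc n + r ^ Suc n * (\<Sum>i<n. 2 ^ Suc i - 1) = r ^ Suc n * (2 ^ Suc n - 1)"
    unfolding sum_powers_of_two by (simp add: algebra_simps)
  finally show ?case by simp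
qed

section \<open>The substitutions \<open>v = u ^ 2\<close> and \<open>x = (u - 1) / 2\<close>\<close>

lemma coeff_pcompose_square:
  fixes p :: "'a :: comm_semiring_1 poly"
  shows "coeff (pcompose p [:0, 0, 1:]) k = (if even k then coeff p (k div 2) else 0)"
proof (induction p arbitrary: k)
  case (pCons a p)
  show ?case
  proof (cases "k \<ge> 2")
    case True
    then obtain j where "k = Suc (Suc j)" by (metis Suc_le_D numeral_2_eq_2 Suc_le_mono)
    then show ?thesis by (simp add: pcompose_pCons coeff_pCons pCons)
  next
    case False
    then have "k = 0 \<or> k = 1" by auto
    then show ?thesis by (auto simp: pcompose_pCons coeff_pCons)
  qed
qed simp

text \<open>Substituting \<open>x = (u - 1) / 2\<close> turns a linear factor into a multiple of
  \<open>1 - u / (1 + 2 * \<zeta>)\<close>. This is the form with constant term 1 that Newton's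
  identities expect, at the price of inverting the roots.\<close>

lemma prod_linear_factors_affine:
  fixes Z :: "complex multiset"
  assumes "\<And>\<zeta>. \<zeta> \<in># Z \<Longrightarrow> 1 + 2 * \<zeta> \<noteq> 0"
  shows "\<exists>c. pcompose (\<Prod>\<zeta>\<in>#Z. [:- \<zeta>, 1:]) [:- 1 / 2, 1 / 2:] =
    smult c (\<Prod>\<zeta>\<in>#Z. [:1, - inverse (1 + 2 * \<zeta>):])"
  using assms
proof (induction Z)
  case empty
  show ?case by (rule exI[of _ 1]) (simp add: pcompose_1)
next
  case (add \<zeta> Z)
  then obtain c where c: "pcompose (\<Prod>\<zeta>\<in>#Z. [:- \<zeta>, 1:]) [:- 1 / 2, 1 / 2:] =
    smult c (\<Prod>\<zeta>\<in>#Z. [:1, - inverse (1 + 2 * \<zeta>):])" by auto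
  define u where "u = 1 + 2 * \<zeta>"
  have u: "u \<noteq> 0" using add.prems by (simp add: u_def)
  have "pcompose [:- \<zeta>, 1:] [:- 1 / 2, 1 / 2:] = smult (- u / 2) [:1, - inverse u:]"
    using u by (simp add: pcompose_pCons) (simp add: u_def)
  then have "pcompose (\<Prod>\<zeta>\<in>#add_mset \<zeta> Z. [:- \<zeta>, 1:]) [:- 1 / 2, 1 / 2:] =
     smult (c * (- u / 2)) (\<Prod>\<zeta>\<in>#add_mset \<zeta> Z. [:1, - inverse (1 + 2 * \<zeta>):])"
    by (simp only: image_mset_add_mset prod_mset.add_mset pcompose_mult c mult_smult_left mult_smult_right
        smult_smult u_def[symmetric])
  then show ?case by blast
qed

section \<open>Weyl's criterion on the unit circle\<close>

lemma sum_mset_norm_diff_le: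
  fixes f g :: "'a \<Rightarrow> 'b :: real_normed_vector"
  assumes "\<And>x. x \<in># M \<Longrightarrow> norm (f x - g x) \<le> e"
  shows "norm ((\<Sum>x\<in>#M. f x) - (\<Sum>x\<in>#M. g x)) \<le> e * size M"
  using assms
proof (induction M)
  case (add x M)
  have "norm ((f x - g x) + ((\<Sum>x\<in>#M. f x) - (\<Sum>x\<in>#M. g x))) \<le> e + e * size M"
    using add by (intro norm_triangle_mono) auto
  then show ?case by (simp add: algebra_simps)
qed simp

text \<open>Orthogonality of characters, stated as a quotient so that Laurent polynomials need only
  natural exponents.\<close>

lemma has_integral_cis_power_quotient:
  "((\<lambda>t. cis t ^ j / cis t ^ N) has_integral (if j = N then 2 * pi else 0)) {0..2 * pi}"
proof (cases "j = N")
  case True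
  then show ?thesis
    using has_integral_const_real[of "1 :: complex" 0 "2 * pi"] by (simp add: scaleR_conv_of_real)
next
  case False
  define a where "a = \<i> * (of_int (int j - int N) :: complex)"
  have a: "a \<noteq> 0" using False by (simp add: a_def)
  have eq: "exp (a * of_real t) = cis t ^ j / cis t ^ N" for t
    by (simp add: cis_conv_exp a_def exp_of_nat_mult[symmetric] exp_diff[symmetric] algebra_simps)
  have "((\<lambda>z. exp (a * z) / a) has_field_derivative exp (a * z)) (at z)" for z
    using a by (auto intro!: derivative_eq_intros)
  then have "((\<lambda>t. exp (a * of_real t) / a) has_vector_derivative exp (a * of_real t)) (at t within {0..2 * pi})" for t
    using has_vector_derivative_real_field by blast
  then have "((\<lambda>t. exp (a * of_real t)) has_integral
      (exp (a * of_real (2 * pi)) / a - exp (a * of_real 0) / a)) {0..2 * pi}"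
    by (intro fundamental_theorem_of_calculus) auto
  moreover have "exp (a * of_real (2 * pi)) = 1"
    unfolding exp_eq_1 by (auto simp: a_def intro!: exI[of _ "int j - int N"])
  ultimately show ?thesis using False by (simp add: eq[symmetric])
qed

lemma inverse_eq_cnj: "norm u = 1 \<Longrightarrow> inverse u = cnj u"
  using complex_div_cnj[of 1 u] by (simp add: inverse_eq_divide)

text \<open>On the circle \<open>cnj u = 1 / u\<close>, so a polynomial in the real and imaginary
  parts becomes a Laurent polynomial in \<open>u\<close>.\<close>

lemma real_polynomial_function_on_circle:
  assumes "real_polynomial_function (g :: complex \<Rightarrow> real)"
  shows "\<exists>p N. \<forall>u. norm u = 1 \<longrightarrow> of_real (g u) = poly p u / u ^ N"
  using assms
proof (induction rule: real_polynomial_function.induct)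
  case (linear f)
  \<comment> \<open>Chosen so that \<open>b * u + cnj b * cnj u\<close> is
    \<open>Re u * f 1 + Im u * f \<i>\<close>.\<close>
  define b where "b = Complex (f 1 / 2) (- f \<i> / 2)"
  have "of_real (f u) = poly [:cnj b, 0, b:] u / u ^ 1" if u: "norm u = 1" for u
  proof -
    have u0: "u \<noteq> 0" using u by auto
    have "u = Re u *\<^sub>R 1 + Im u *\<^sub>R \<i>" by (simp add: complex_eq_iff)
    then have "f u = f (Re u *\<^sub>R 1 + Im u *\<^sub>R \<i>)" by (rule arg_cong)
    also have "\<dots> = Re u * f 1 + Im u * f \<i>"
      using bounded_linear.linear[OF linear] by (simp only: linear_add linear_scale real_scaleR_def)
    finally have "f u = Re u * f 1 + Im u * f \<i>" .
    then have "of_real (f u) = b * u + cnj b * cnj u"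
      by (simp add: b_def complex_eq_iff)
    also have "cnj u = 1 / u" using inverse_eq_cnj[OF u] by (simp add: inverse_eq_divide)
    also have "b * u + cnj b * (1 / u) = poly [:cnj b, 0, b:] u / u ^ 1"
      using u0 by (simp add: add_divide_distrib)
    finally show ?thesis .
  qed
  then show ?case by blast
next
  case (const c)
  have "of_real c = poly [:of_real c:] u / u ^ 0" for u :: complex by simp
  then show ?case by blast
next
  case (add f g)
  then obtain p N q M where *: "\<And>u. norm u = 1 \<Longrightarrow> of_real (f u) = poly p u / u ^ N"
    "\<And>u. norm u = 1 \<Longrightarrow> of_real (g u) = poly q u / u ^ M" by blast
  have "of_real (f u + g u) = poly (monom 1 M * p + monom 1 N * q) u / u ^ (N + M)"
    if u: "norm u = 1" for u
  proof -
    have "u \<noteq> 0" using u by auto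
    then show ?thesis
      using u by (simp add: * poly_monom add_divide_distrib power_add mult.commute)
  qed
  then show ?case by blast
next
  case (mult f g)
  then obtain p N q M where *: "\<And>u. norm u = 1 \<Longrightarrow> of_real (f u) = poly p u / u ^ N"
    "\<And>u. norm u = 1 \<Longrightarrow> of_real (g u) = poly q u / u ^ M" by blast
  have "of_real (f u * g u) = poly (p * q) u / u ^ (N + M)" if u: "norm u = 1" for u
    using u by (simp add: * power_add)
  then show ?case by blast
qed

text \<open>The moments settle Laurent polynomials, and Stone-Weierstrass extends the limit to
  continuous functions by uniform approximation.\<close>

lemma weyl_criterion_circle:
  fixes U :: "nat \<Rightarrow> complex multiset" and f :: "complex \<Rightarrow> real"
  assumes unit: "\<And>n u. u \<in># U n \<Longrightarrow> norm u = 1"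
    and ne: "eventually (\<lambda>n. U n \<noteq> {#}) sequentially"
    and mom: "\<And>k. k > 0 \<Longrightarrow> (\<lambda>n. (\<Sum>u\<in>#U n. u ^ k) / of_nat (size (U n))) \<longlonglongrightarrow> 0"
    and f: "continuous_on (sphere 0 1) f"
  shows "(\<lambda>n. (\<Sum>u\<in>#U n. f u) / size (U n)) \<longlonglongrightarrow> integral {0..2 * pi} (\<lambda>t. f (cis t)) / (2 * pi)"
proof -
  define avg where "avg g n = (\<Sum>u\<in>#U n. g u) / of_nat (size (U n))" for g :: "complex \<Rightarrow> complex" and n
  define J where "J g = integral {0..2 * pi} (\<lambda>t. g (cis t)) / (2 * pi)" for g :: "complex \<Rightarrow> complex"
  have avg_cong: "avg g n = avg h n" if "\<And>u. norm u = 1 \<Longrightarrow> g u = h u" for g h n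
  proof -
    have "image_mset g (U n) = image_mset h (U n)"
      by (rule image_mset_cong) (use that unit in blast)
    then show ?thesis by (simp only: avg_def)
  qed
  have monomial: "avg (\<lambda>u. u ^ j / u ^ N) \<longlonglongrightarrow> (if j = N then 1 else 0)" for j N
  proof -
    consider "j = N" | d where "j = N + d" "d > 0" | d where "N = j + d" "d > 0"
      by (metis less_imp_add_positive linorder_neqE_nat)
    then show ?thesis
    proof cases
      case 1
      have "avg (\<lambda>u. u ^ j / u ^ N) n = avg (\<lambda>u. 1) n" for n
        by (rule avg_cong) (use 1 in auto)
      \<comment> \<open>Nonemptiness matters here: over an empty multiset the average is 0 by
        division by zero.\<close>
      moreover have "eventually (\<lambda>n. avg (\<lambda>u. 1) n = 1) sequentially"
        using ne by eventually_elim (simp add: avg_def)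
      ultimately show ?thesis using 1 by (auto intro: tendsto_eventually)
    next
      case (2 d)
      have *: "avg (\<lambda>u. u ^ j / u ^ N) = avg (\<lambda>u. u ^ d)"
        by (rule ext, rule avg_cong) (use 2 in \<open>auto simp: power_add\<close>)
      moreover have "avg (\<lambda>u. u ^ d) \<longlonglongrightarrow> 0" unfolding avg_def by (rule mom[OF 2(2)])
      ultimately show ?thesis unfolding * using 2 by simp
    next
      case (3 d)
      \<comment> \<open>Negative moments are conjugates of positive ones, because the points lie on
        the circle.\<close>
      have *: "avg (\<lambda>u. u ^ j / u ^ N) = (\<lambda>n. cnj (avg (\<lambda>u. u ^ d) n))"
      proof
        fix n
        have "avg (\<lambda>u. u ^ j / u ^ N) n = avg (\<lambda>u. cnj (u ^ d)) n"
        proof (rule avg_cong)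
          fix u :: complex assume u: "norm u = 1"
          then have "u \<noteq> 0" by auto
          then have "u ^ j / u ^ N = inverse u ^ d" by (simp add: 3 power_add divide_inverse power_inverse)
          also have "inverse u = cnj u" by (rule inverse_eq_cnj[OF u])
          finally show "u ^ j / u ^ N = cnj (u ^ d)" by simp
        qed
        also have "\<dots> = cnj (avg (\<lambda>u. u ^ d) n)"
        proof -
          have "(\<Sum>u\<in>#M. cnj (u ^ d)) = cnj (\<Sum>u\<in>#M. u ^ d)" for M by (induction M) auto
          then show ?thesis by (simp add: avg_def)
        qed
        finally show "avg (\<lambda>u. u ^ j / u ^ N) n = cnj (avg (\<lambda>u. u ^ d) n)" .
      qed
      have "(\<lambda>n. cnj (avg (\<lambda>u. u ^ d) n)) \<longlonglongrightarrow> cnj 0"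
        unfolding avg_def using mom[OF 3(2)] by (rule tendsto_cnj)
      then show ?thesis unfolding * using 3 by simp
    qed
  qed
  have laurent: "avg (\<lambda>u. poly p u / u ^ N) \<longlonglongrightarrow> J (\<lambda>u. poly p u / u ^ N)" for p N
  proof -
    have e: "poly p u / u ^ N = (\<Sum>j\<le>degree p. coeff p j * (u ^ j / u ^ N))" for u
      by (simp add: poly_altdef sum_divide_distrib)
    have *: "avg (\<lambda>u. poly p u / u ^ N) =
        (\<lambda>n. \<Sum>j\<le>degree p. coeff p j * avg (\<lambda>u. u ^ j / u ^ N) n)"
    proof
      fix n
      have "(\<Sum>u\<in>#M. poly p u / u ^ N) = (\<Sum>j\<le>degree p. coeff p j * (\<Sum>u\<in>#M. u ^ j / u ^ N))" for M
        by (induction M) (simp_all add: e distrib_left sum.distrib)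
      then show "avg (\<lambda>u. poly p u / u ^ N) n = (\<Sum>j\<le>degree p. coeff p j * avg (\<lambda>u. u ^ j / u ^ N) n)"
        by (simp add: avg_def sum_divide_distrib)
    qed
    have "(\<lambda>n. \<Sum>j\<le>degree p. coeff p j * avg (\<lambda>u. u ^ j / u ^ N) n) \<longlonglongrightarrow>
        (\<Sum>j\<le>degree p. coeff p j * (if j = N then 1 else 0))"
      by (intro tendsto_sum tendsto_mult tendsto_const monomial)
    moreover have "((\<lambda>t. poly p (cis t) / cis t ^ N) has_integral
        (\<Sum>j\<le>degree p. coeff p j * (if j = N then 2 * pi else 0))) {0..2 * pi}"
      unfolding e by (intro has_integral_sum has_integral_mult_right has_integral_cis_power_quotient) auto
    then have "J (\<lambda>u. poly p u / u ^ N) = (\<Sum>j\<le>degree p. coeff p j * (if j = N then 1 else 0))"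
      unfolding J_def by (subst integral_unique) (auto simp: sum_divide_distrib intro!: sum.cong)
    ultimately show ?thesis by (simp only: *)
  qed
  have cont: "continuous_on {0..2 * pi} (\<lambda>t. g (cis t))"
    if "continuous_on (sphere 0 1) g" for g :: "complex \<Rightarrow> real"
    by (intro continuous_on_compose2[OF that] continuous_intros) auto
  note cont_int = integrable_continuous_real[OF cont]
  show ?thesis
  proof (rule LIMSEQ_I)
    fix r :: real assume r: "r > 0"
    \<comment> \<open>One third each for replacing \<open>f\<close> by \<open>g\<close> in the
      average, for the limit of the average of \<open>g\<close>, and for replacing \<open>f\<close>
      by \<open>g\<close> in the integral.\<close>
    define e where "e = r / 3"
    have e: "e > 0" using r by (simp add: e_def)
    obtain g where g: "real_polynomial_function g" "\<And>u. norm u = 1 \<Longrightarrow> \<bar>f u - g u\<bar> < e"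
      using Stone_Weierstrass_real_polynomial_function[OF _ f e] by auto
    obtain p N where p: "\<And>u. norm u = 1 \<Longrightarrow> of_real (g u) = poly p u / u ^ N"
      using real_polynomial_function_on_circle[OF g(1)] by blast
    have g_cont: "continuous_on (sphere 0 1) g"
      using g(1) by (intro continuous_on_polymonial_function) (simp add: real_polynomial_function_eq)
    have "avg (\<lambda>u. of_real (g u)) n = avg (\<lambda>u. poly p u / u ^ N) n" for n
      by (rule avg_cong) (rule p)
    moreover have "J (\<lambda>u. poly p u / u ^ N) = of_real (integral {0..2 * pi} (\<lambda>t. g (cis t)) / (2 * pi))"
    proof -
      have "((\<lambda>t. complex_of_real (g (cis t))) has_integral of_real (integral {0..2 * pi} (\<lambda>t. g (cis t)))) {0..2 * pi}"
        by (intro has_integral_of_real integrable_integral cont_int g_cont)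
      then show ?thesis unfolding J_def by (simp add: p[symmetric] integral_unique)
    qed
    moreover have "avg (\<lambda>u. of_real (g u)) n = of_real ((\<Sum>u\<in>#U n. g u) / size (U n))" for n
    proof -
      have "(\<Sum>u\<in>#M. complex_of_real (g u)) = of_real (\<Sum>u\<in>#M. g u)" for M by (induction M) auto
      then show ?thesis by (simp add: avg_def)
    qed
    ultimately have "(\<lambda>n. complex_of_real ((\<Sum>u\<in>#U n. g u) / size (U n))) \<longlonglongrightarrow>
        of_real (integral {0..2 * pi} (\<lambda>t. g (cis t)) / (2 * pi))"
      using laurent[of p N] by simp
    then have "(\<lambda>n. (\<Sum>u\<in>#U n. g u) / size (U n)) \<longlonglongrightarrow> integral {0..2 * pi} (\<lambda>t. g (cis t)) / (2 * pi)"
      by (simp only: tendsto_of_real_iff)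
    then have ev: "eventually (\<lambda>n. dist ((\<Sum>u\<in>#U n. g u) / size (U n)) (integral {0..2 * pi} (\<lambda>t. g (cis t)) / (2 * pi)) < e) sequentially"
      using e by (rule tendstoD)
    have J: "\<bar>integral {0..2 * pi} (\<lambda>t. f (cis t)) / (2 * pi) - integral {0..2 * pi} (\<lambda>t. g (cis t)) / (2 * pi)\<bar> \<le> e"
    proof -
      have "norm (integral {0..2 * pi} (\<lambda>t. f (cis t) - g (cis t))) \<le> e * (2 * pi - 0)"
      proof (rule integral_bound)
        show "continuous_on {0..2 * pi} (\<lambda>t. f (cis t) - g (cis t))"
          by (intro continuous_on_diff cont f g_cont)
        show "norm (f (cis t) - g (cis t)) \<le> e" for t
          using less_imp_le[OF g(2)] by simp
      qed simp
      then have "\<bar>integral {0..2 * pi} (\<lambda>t. f (cis t)) - integral {0..2 * pi} (\<lambda>t. g (cis t))\<bar> \<le> e * (2 * pi)"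
        by (simp add: Henstock_Kurzweil_Integration.integral_diff cont_int f g_cont)
      then have "\<bar>integral {0..2 * pi} (\<lambda>t. f (cis t)) - integral {0..2 * pi} (\<lambda>t. g (cis t))\<bar> / \<bar>2 * pi\<bar> \<le> e"
        by (simp add: pos_divide_le_eq)
      then show ?thesis by (simp only: abs_divide diff_divide_distrib[symmetric])
    qed
    have "eventually (\<lambda>n. norm ((\<Sum>u\<in>#U n. f u) / size (U n) - integral {0..2 * pi} (\<lambda>t. f (cis t)) / (2 * pi)) < r) sequentially"
      using ev ne
    proof eventually_elim
      case (elim n)
      have "norm ((\<Sum>u\<in>#U n. f u) - (\<Sum>u\<in>#U n. g u)) \<le> e * size (U n)"
        using unit by (intro sum_mset_norm_diff_le) (auto intro!: less_imp_le g(2))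
      then have "\<bar>(\<Sum>u\<in>#U n. f u) - (\<Sum>u\<in>#U n. g u)\<bar> / \<bar>real (size (U n))\<bar> \<le> e"
        using elim(2) by (simp add: pos_divide_le_eq nonempty_has_size)
      then have "\<bar>(\<Sum>u\<in>#U n. f u) / size (U n) - (\<Sum>u\<in>#U n. g u) / size (U n)\<bar> \<le> e"
        by (simp only: abs_divide diff_divide_distrib[symmetric])
      moreover have "\<bar>(\<Sum>u\<in>#U n. g u) / size (U n) - integral {0..2 * pi} (\<lambda>t. g (cis t)) / (2 * pi)\<bar> < e"
        using elim(1) by (simp add: dist_real_def)
      ultimately show ?case using J unfolding real_norm_def e_def by linarith
    qed
    then show "\<exists>n0. \<forall>n\<ge>n0. norm ((\<Sum>u\<in>#U n. f u) / size (U n) - integral {0..2 * pi} (\<lambda>t. f (cis t)) / (2 * pi)) < r"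
      by (simp only: eventually_sequentially)
  qed
qed

section \<open>Integrals against the two measures\<close>

lemma integral_zero_counting_measure:
  fixes h :: "complex \<Rightarrow> real"
  assumes "ratfun_zeros r \<noteq> {#}" "h \<in> borel_measurable borel"
  shows "(\<integral>z. h z \<partial>zero_counting_measure r) = (\<Sum>\<zeta>\<in>#ratfun_zeros r. h \<zeta>) / size (ratfun_zeros r)"
proof -
  let ?Z = "ratfun_zeros r"
  have "(\<integral>z. h z \<partial>zero_counting_measure r) = (\<integral>z. h z \<partial>measure_pmf (pmf_of_multiset ?Z))"
    unfolding zero_counting_measure_def using assms by (subst integral_distr) auto
  also have "\<dots> = (\<Sum>z\<in>set_mset ?Z. pmf (pmf_of_multiset ?Z) z *\<^sub>R h z)"
    using assms by (intro integral_measure_pmf) auto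
  also have "\<dots> = (\<Sum>\<zeta>\<in>#?Z. h \<zeta>) / size ?Z"
    unfolding sum_mset_eq_sum_count sum_divide_distrib using assms by (intro sum.cong) auto
  finally show ?thesis .
qed

text \<open>Translates the Lebesgue integral into the gauge integral of Weyl's criterion; they agree
  for continuous integrands on a compact interval.\<close>

lemma integral_circle_measure:
  fixes h :: "complex \<Rightarrow> real"
  assumes "continuous_on UNIV h"
  shows "(\<integral>z. h z \<partial>circle_measure c r) = integral {0..2 * pi} (\<lambda>t. h (c + of_real r * cis t)) / (2 * pi)"
proof -
  let ?g = "\<lambda>t. h (c + of_real r * cis t)"
  have g: "continuous_on UNIV ?g"
    by (intro continuous_on_compose2[OF assms] continuous_intros) auto
  then have [measurable]: "?g \<in> borel_measurable borel" by (rule borel_measurable_continuous_onI)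
  have [measurable]: "h \<in> borel_measurable borel" using assms by (rule borel_measurable_continuous_onI)
  have [measurable]: "(\<lambda>t. c + of_real r * cis t) \<in> borel_measurable borel"
    by (intro borel_measurable_continuous_onI continuous_intros)
  have u: "uniform_measure lborel {0..2 * pi} = density lborel (\<lambda>t. ennreal (indicator {0..2 * pi} t / (2 * pi)))"
    unfolding uniform_measure_def
    by (rule density_cong) (auto simp: ennreal_divide_numeral indicator_def divide_ennreal[symmetric] ennreal_mult)
  have "(\<integral>z. h z \<partial>circle_measure c r) = (\<integral>t. ?g t \<partial>uniform_measure lborel {0..2 * pi})"
    unfolding circle_measure_def by (subst integral_distr) auto
  also have "\<dots> = (\<integral>t. (indicator {0..2 * pi} t / (2 * pi)) *\<^sub>R ?g t \<partial>lborel)"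
    unfolding u by (rule integral_density) auto
  also have "\<dots> = (LINT t:{0..2 * pi}|lborel. ?g t) / (2 * pi)"
    unfolding set_lebesgue_integral_def by (simp flip: integral_divide_zero)
  also have "(LINT t:{0..2 * pi}|lborel. ?g t) = integral {0..2 * pi} ?g"
    by (intro set_borel_integral_eq_integral borel_integrable_atLeastAtMost' continuous_on_subset[OF g]) auto
  finally show ?thesis .
qed

section \<open>Moments of the zeros\<close>

text \<open>For \<open>k = 2 * j\<close> the coefficient \<open>central j * central (m - j)\<close>
  is at most \<open>central (m - j)\<close>, hence at most \<open>2 ^ j * central m\<close>. The
  bound is relative to the constant term \<open>central m\<close>, by which the polynomial is
  normalized later.\<close>

lemma norm_coeff_legpoly_square_le:
  "norm (coeff (pcompose (legpoly m) [:0, 0, 1:]) k) \<le> central m * 2 ^ k"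
proof (cases "even k \<and> k div 2 \<le> m")
  case True
  define j where "j = k div 2"
  have j: "m - j + j = m" using True by (simp add: j_def)
  have "central j * central (m - j) \<le> 1 * (2 ^ j * central (m - j + j))"
    using central_pos by (intro mult_mono central_le_1 central_le_double less_imp_le) auto
  also have "\<dots> \<le> 2 ^ k * central m"
    unfolding j mult_1 using central_pos[of m]
    by (intro mult_right_mono power_increasing) (auto simp: j_def)
  finally show ?thesis
    using True central_pos[of j] central_pos[of "m - j"]
    by (simp add: coeff_pcompose_square coeff_legpoly norm_mult j_def mult.commute)
next
  case False
  then show ?thesis using central_pos[of m] by (auto simp: coeff_pcompose_square coeff_legpoly)
qed

text \<open>The bound is free of \<open>m\<close>. Newton's identities control the inverses of the
  values \<open>1 + 2 * \<zeta>\<close>; on the unit circle these are conjugates, so the power sums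
  have the same norm.\<close>

lemma psi_power_sum_le:
  "norm (\<Sum>\<zeta>\<in>#ratfun_zeros (psi (Suc m)). (1 + 2 * \<zeta>) ^ Suc n) \<le> 2 ^ Suc n * (2 ^ Suc n - 1)"
proof -
  define Z where "Z = ratfun_zeros (psi (Suc m))"
  define R where "R = pcompose (legpoly m) [:0, 0, 1 :: complex:]"
  define A where "A = image_mset (\<lambda>\<zeta>. inverse (1 + 2 * \<zeta>)) Z"
  have unit: "norm (1 + 2 * \<zeta>) = 1" if "\<zeta> \<in># Z" for \<zeta>
    using that psi_zero_norm by (simp add: Z_def)
  then obtain c where c: "pcompose (\<Prod>\<zeta>\<in>#Z. [:- \<zeta>, 1:]) [:- 1 / 2, 1 / 2:] =
      smult c (\<Prod>\<zeta>\<in>#Z. [:1, - inverse (1 + 2 * \<zeta>):])"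
    using prod_linear_factors_affine[of Z] by force
  have "R = pcompose (psi_num m) [:- 1 / 2, 1 / 2:]"
    unfolding R_def psi_num_def pcompose_assoc[symmetric]
    by (rule arg_cong[of _ _ "pcompose (legpoly m)"]) (simp add: power2_eq_square pcompose_pCons pcompose_mult)
  also have "psi_num m = smult (lead_coeff (psi_num m)) (\<Prod>\<zeta>\<in>#Z. [:- \<zeta>, 1:])"
    unfolding Z_def ratfun_zeros_psi by (rule complex_poly_decompose_multiset[symmetric])
  finally obtain c' where R: "R = smult c' (\<Prod>a\<in>#A. [:1, - a:])"
    unfolding pcompose_smult c by (simp add: A_def multiset.map_comp o_def)
  have "coeff (\<Prod>a\<in>#A. [:1, - a:]) 0 = 1"
    by (induction A) (auto simp: coeff_mult)
  moreover have "coeff R 0 = of_real (central m)"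
    unfolding R_def coeff_pcompose_square by (simp add: coeff_legpoly)
  \<comment> \<open>The product has constant term 1, so the scalar is the constant term of
    \<open>R\<close>.\<close>
  ultimately have c': "c' = of_real (central m)" by (simp add: R)
  have "norm (coeff (\<Prod>a\<in>#A. [:1, - a:]) k) \<le> 2 ^ k" for k
  proof -
    have "central m * norm (coeff (\<Prod>a\<in>#A. [:1, - a:]) k) \<le> central m * 2 ^ k"
      using norm_coeff_legpoly_square_le[of m k] central_pos[of m]
      by (simp only: R_def[symmetric] R c' coeff_smult norm_mult norm_of_real abs_of_pos)
    then show ?thesis using central_pos[of m] by (subst (asm) mult_le_cancel_left_pos)
  qed
  then have "norm (\<Sum>a\<in>#A. a ^ Suc n) \<le> 2 ^ Suc n * (2 ^ Suc n - 1)"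
    by (rule norm_power_sum_le) simp
  also have "(\<Sum>a\<in>#A. a ^ Suc n) = (\<Sum>\<zeta>\<in>#Z. cnj ((1 + 2 * \<zeta>) ^ Suc n))"
  proof -
    have "image_mset (\<lambda>\<zeta>. inverse (1 + 2 * \<zeta>) ^ Suc n) Z = image_mset (\<lambda>\<zeta>. cnj ((1 + 2 * \<zeta>) ^ Suc n)) Z"
      by (rule image_mset_cong) (simp only: complex_cnj_power inverse_eq_cnj[OF unit])
    then show ?thesis by (simp only: A_def multiset.map_comp o_def)
  qed
  also have "\<dots> = cnj (\<Sum>\<zeta>\<in>#Z. (1 + 2 * \<zeta>) ^ Suc n)"
    by (induction Z) auto
  finally show ?thesis unfolding complex_mod_cnj Z_def .
qed

section \<open>Equidistribution and location of the zeros\<close>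

lemma size_ratfun_zeros_psi: "size (ratfun_zeros (psi (Suc m))) = 2 * m"
  by (simp add: ratfun_zeros_psi size_proots_complex degree_psi_num)

theorem theorem2p5:
  shows "weak_star_converges (\<lambda>n. zero_counting_measure (psi n)) (circle_measure (- 1 / 2) (1 / 2)) \<and>
    (\<forall>\<epsilon>>0. \<exists>n\<^sub>0. \<forall>n\<ge>n\<^sub>0. n \<ge> 1 \<longrightarrow>
       (\<forall>\<zeta>\<in>#ratfun_zeros (psi n). infdist \<zeta> (sphere (- 1 / 2) (1 / 2)) < \<epsilon>))"
proof
  show "weak_star_converges (\<lambda>n. zero_counting_measure (psi n)) (circle_measure (- 1 / 2) (1 / 2))"
    unfolding weak_star_converges_def
  proof (intro allI impI, elim conjE)
    fix h :: "complex \<Rightarrow> real" assume h: "continuous_on UNIV h"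
    define Z where "Z m = ratfun_zeros (psi (Suc m))" for m
    define U where "U m = image_mset (\<lambda>\<zeta>. 1 + 2 * \<zeta>) (Z m)" for m
    \<comment> \<open>Transports \<open>h\<close> along \<open>x = (u - 1) / 2\<close>, which maps
      the unit circle onto the target circle.\<close>
    define f where "f u = h ((u - 1) / 2)" for u
    have size: "size (Z m) = 2 * m" for m by (simp add: Z_def size_ratfun_zeros_psi)
    \<comment> \<open>At \<open>m = 0\<close> there are no zeros and the counting measure is a junk
      value.\<close>
    have ne: "eventually (\<lambda>m. Z m \<noteq> {#}) sequentially"
      using eventually_gt_at_top[of 0]
    proof eventually_elim
      case (elim m)
      then have "size (Z m) \<noteq> 0" by (simp only: size)
      then show ?case by auto
    qed
    have lim: "(\<lambda>m. (\<Sum>u\<in>#U m. f u) / size (U m)) \<longlonglongrightarrow> integral {0..2 * pi} (\<lambda>t. f (cis t)) / (2 * pi)"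
    proof (rule weyl_criterion_circle)
      show "norm u = 1" if "u \<in># U m" for m u
        using that psi_zero_norm by (auto simp: U_def Z_def)
      show "eventually (\<lambda>m. U m \<noteq> {#}) sequentially"
        using ne by (simp add: U_def)
      show "continuous_on (sphere 0 1) f"
        unfolding f_def by (intro continuous_on_compose2[OF h] continuous_intros) auto
      fix k :: nat assume "k > 0"
      then obtain n where k: "k = Suc n" using gr0_conv_Suc by auto
      \<comment> \<open>A bound on the power sum that is constant in \<open>m\<close>; divided by
        the \<open>2 * m\<close> zeros it tends to 0.\<close>
      define B :: real where "B = 2 ^ k * (2 ^ k - 1)"
      have bound: "norm ((\<Sum>u\<in>#U m. u ^ k) / of_nat (size (U m))) \<le> B / 2 * (1 / real m)" for m
      proof -
        have "norm (\<Sum>u\<in>#U m. u ^ k) \<le> B"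
          unfolding B_def k U_def Z_def multiset.map_comp o_def by (rule psi_power_sum_le)
        then have "norm (\<Sum>u\<in>#U m. u ^ k) / real (2 * m) \<le> B / real (2 * m)"
          by (rule divide_right_mono) simp
        moreover have "size (U m) = 2 * m" by (simp add: U_def size)
        ultimately show ?thesis by (simp only: norm_divide norm_of_nat) simp
      qed
      have "(\<lambda>m. B / 2 * (1 / real m)) \<longlonglongrightarrow> B / 2 * 0"
        by (intro tendsto_mult tendsto_const lim_1_over_n)
      then have "(\<lambda>m. B / 2 * (1 / real m)) \<longlonglongrightarrow> 0" by simp
      then show "(\<lambda>m. (\<Sum>u\<in>#U m. u ^ k) / of_nat (size (U m))) \<longlonglongrightarrow> 0"
        by (rule Lim_null_comparison[rotated]) (simp only: bound eventually_True)
    qed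
    have J: "integral {0..2 * pi} (\<lambda>t. f (cis t)) / (2 * pi) = (\<integral>z. h z \<partial>circle_measure (- 1 / 2) (1 / 2))"
      unfolding integral_circle_measure[OF h] by (simp add: f_def diff_divide_distrib)
    have ev: "eventually (\<lambda>m. (\<Sum>u\<in>#U m. f u) / size (U m) =
        (\<integral>z. h z \<partial>zero_counting_measure (psi (Suc m)))) sequentially"
      using ne
    proof eventually_elim
      case (elim m)
      have [measurable]: "h \<in> borel_measurable borel" using h by (rule borel_measurable_continuous_onI)
      have "(\<integral>z. h z \<partial>zero_counting_measure (psi (Suc m))) = (\<Sum>\<zeta>\<in>#Z m. h \<zeta>) / size (Z m)"
        unfolding Z_def by (rule integral_zero_counting_measure) (use elim in \<open>auto simp: Z_def\<close>)
      then show ?case by (simp add: U_def f_def multiset.map_comp o_def)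
    qed
    have "(\<lambda>m. \<integral>z. h z \<partial>zero_counting_measure (psi (Suc m))) \<longlonglongrightarrow>
        (\<integral>z. h z \<partial>circle_measure (- 1 / 2) (1 / 2))"
      using Lim_transform_eventually[OF lim ev] by (simp only: J)
    then show "(\<lambda>n. \<integral>z. h z \<partial>zero_counting_measure (psi n)) \<longlonglongrightarrow>
        (\<integral>z. h z \<partial>circle_measure (- 1 / 2) (1 / 2))"
      by (rule LIMSEQ_imp_Suc)
  qed
next
  \<comment> \<open>The zeros lie exactly on the circle, so the distance is 0 and every threshold
    works.\<close>
  have "infdist \<zeta> (sphere (- 1 / 2) (1 / 2)) = 0" if "n \<ge> 1" "\<zeta> \<in># ratfun_zeros (psi n)" for n \<zeta>
  proof -
    obtain m where "n = Suc m" using \<open>n \<ge> 1\<close> by (cases n) auto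
    with that have "norm (1 + 2 * \<zeta>) = 1" using psi_zero_norm by simp
    moreover have "- 1 / 2 - \<zeta> = - (1 + 2 * \<zeta>) / 2" by (simp add: add_divide_distrib)
    ultimately have "dist (- 1 / 2) \<zeta> = 1 / 2"
      unfolding dist_norm by (simp only: norm_divide norm_minus_cancel) simp
    then have "\<zeta> \<in> sphere (- 1 / 2) (1 / 2)" by simp
    then show ?thesis by (rule infdist_zero)
  qed
  then show "\<forall>\<epsilon>>0. \<exists>n\<^sub>0. \<forall>n\<ge>n\<^sub>0. n \<ge> 1 \<longrightarrow>
       (\<forall>\<zeta>\<in>#ratfun_zeros (psi n). infdist \<zeta> (sphere (- 1 / 2) (1 / 2)) < \<epsilon>)"
    by simp
qed

end
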